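(* There are an absolute constant $C$ and a constant $b_0$ such that for every $n\in\frac12\mathbb{Z}$ the following holds. For $0\le t\le1$ the spherical function $\zeta_{n,1/2+i\lambda}(a_t)$ decomposes as $$\zeta_{n,1/2+i\lambda}(a_t)=\Big(\frac{t}{\sinh t}\Big)^{1/2}\sum_{j=0}^{2}t^{2j}\,b_j^n(t)\,\mathcal{J}_j(\lambda t)+E_n(\lambda,t),\qquad\lambda\ge0,$$ where $b_0^n\equiv b_0$ is a constant independent of $n$, while $|b^n_j(t)|\le C(1+|n|)^4$ for $j=1,2$, and $$\int_1^\infty|E_n(\lambda,t)|\,\lambda\,d\lambda\le C(1+|n|)^6\qquad\text{uniformly in }0\le t\le1 .$$
   Context: $G=SL(2,\mathbb{R})$, with $$n_\xi=\begin{pmatrix}1&\xi/2\\0&1\end{pmatrix},\quad a_t=\begin{pmatrix}e^{t/2}&0\\0&e^{-t/2}\end{pmatrix},\quad u_\theta=\begin{pmatrix}\cos(\theta/2)&\sin(\theta/2)\\-\sin(\theta/2)&\cos(\theta/2)\end{pmatrix},$$ $\xi,t\in\mathbb{R}$, $\theta\in[0,4\pi)$; every element of $G$ is uniquely $n_\xi a_tu_\theta$. For $s\in\mathbb{C}$, $n\in\frac12\mathbb{Z}$ define $\alpha_s(n_\xi a_tu_\theta)=e^{st}$, $\chi_n(n_\xi a_tu_\theta)=e^{in\theta}$, and the spherical function $$\zeta_{n,s}(x)=\frac1{4\pi}\int_0^{4\pi}(\alpha_s\chi_n)(u_\theta x)\,e^{-in\theta}\,d\theta,\qquad x\in G .$$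 For $\tau\ge0$, $$\mathcal{J}_\tau(z)=\frac{J_\tau(|z|)}{|z|^\tau}\,2^{\tau-1}\,\Gamma(\tau+1/2),\qquad z\in\mathbb{R},$$ where $J_\tau$ is the Bessel function of the first kind (with the value at $z=0$ given by continuity). The functions $b^n_j$ depend only on $t$ (and $n$), not on $\lambda$; $(t/\sinh t)^{1/2}$ is $1$ at $t=0$. *)

theory Defs
  imports "HOL-Analysis.Analysis"
begin

section \<open>Iwasawa coordinates on SL(2,R)\<close>

definition SL2R :: "(real^2^2) set" where
  "SL2R = {g. det g = 1}"

definition n_mat :: "real \<Rightarrow> real^2^2" where
  "n_mat \<xi> = vector [vector [1, \<xi> / 2], vector [0, 1]]"

definition a_mat :: "real \<Rightarrow> real^2^2" where
  "a_mat t = vector [vector [exp (t / 2), 0], vector [0, exp (- t / 2)]]"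

definition u_mat :: "real \<Rightarrow> real^2^2" where
  "u_mat \<theta> = vector [vector [cos (\<theta> / 2), sin (\<theta> / 2)],
                    vector [- sin (\<theta> / 2), cos (\<theta> / 2)]]"

text \<open>The triple is unique on \<^const>\<open>SL2R\<close>, see \<open>iwasawa_unique\<close>; nothing is said
  about matrices outside it.\<close>

definition iwasawa :: "real^2^2 \<Rightarrow> real \<times> real \<times> real" where
  "iwasawa g = (THE p. case p of (\<xi>, t, \<theta>) \<Rightarrow>
      0 \<le> \<theta> \<and> \<theta> < 4 * pi \<and> g = n_mat \<xi> ** a_mat t ** u_mat \<theta>)"

lemma nau_mat:
  "n_mat \<xi> ** a_mat t ** u_mat \<theta> =
     vector [vector [exp (t/2) * cos (\<theta>/2) - \<xi>/2 * exp (-t/2) * sin (\<theta>/2),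
                     exp (t/2) * sin (\<theta>/2) + \<xi>/2 * exp (-t/2) * cos (\<theta>/2)],
             vector [- exp (-t/2) * sin (\<theta>/2), exp (-t/2) * cos (\<theta>/2)]]"
  by (simp add: vec_eq_iff forall_2 matrix_matrix_mult_def sum_2 n_mat_def a_mat_def u_mat_def)

lemma vector2_eq_iff:
  "(vector [vector [a, b], vector [c, d]] :: real^2^2) = vector [vector [a', b'], vector [c', d']]
     \<longleftrightarrow> a = a' \<and> b = b' \<and> c = c' \<and> d = d'"
  by (auto simp add: vec_eq_iff forall_2)

lemma iwasawa_unique:
  assumes "g \<in> SL2R"
  shows "\<exists>!p. case p of (\<xi>, t, \<theta>) \<Rightarrow>
      0 \<le> \<theta> \<and> \<theta> < 4 * pi \<and> g = n_mat \<xi> ** a_mat t ** u_mat \<theta>"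
proof -
  define a b c d where abcd: "a = g$1$1" "b = g$1$2" "c = g$2$1" "d = g$2$2"
  have g: "g = vector [vector [a, b], vector [c, d]]"
    by (simp add: vec_eq_iff forall_2 abcd)
  have det: "a * d - b * c = 1"
    using assms by (simp add: SL2R_def det_2 abcd)
  define r where "r = sqrt (c\<^sup>2 + d\<^sup>2)"
  have pos: "c\<^sup>2 + d\<^sup>2 > 0"
    using det by (metis add_0 diff_0_right mult_eq_0_iff sum_power2_gt_zero_iff zero_neq_one)
  then have r: "r > 0" and r2: "r\<^sup>2 = c\<^sup>2 + d\<^sup>2" by (simp_all add: r_def)
  have eq_iff: "g = n_mat \<xi> ** a_mat t ** u_mat \<theta> \<longleftrightarrow>
      exp (-t/2) = r \<and> cos (\<theta>/2) = d / r \<and> sin (\<theta>/2) = - c / r \<and> \<xi> / 2 = (a * c + b * d) / r\<^sup>2"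
    (is "?L \<longleftrightarrow> ?R") for \<xi> t \<theta>
  proof -
    define e C S where ecs: "e = exp (-t/2)" "C = cos (\<theta>/2)" "S = sin (\<theta>/2)"
    have e: "e > 0" by (simp add: ecs)
    have "exp (t/2) * e = 1" unfolding ecs(1) mult_exp_exp by simp
    with e have e': "exp (t/2) = 1 / e" by (simp add: eq_divide_eq)
    have cs: "C\<^sup>2 + S\<^sup>2 = 1" by (simp add: ecs)
    have L: "?L \<longleftrightarrow> a = C / e - \<xi>/2 * e * S \<and> b = S / e + \<xi>/2 * e * C \<and> c = - e * S \<and> d = e * C"
      unfolding g nau_mat vector2_eq_iff e' ecs(1,2,3)[symmetric] by simp
    show ?thesis
    proof
      assume ?L
      then have h: "a = C / e - \<xi>/2 * e * S" "b = S / e + \<xi>/2 * e * C" "c = - e * S" "d = e * C"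
        using L by auto
      have "r\<^sup>2 = e\<^sup>2 * (C\<^sup>2 + S\<^sup>2)" unfolding r2 h by (simp add: power2_eq_square algebra_simps)
      then have er: "e = r" using cs e r by (simp add: power2_eq_iff_nonneg)
      have "a * c + b * d = \<xi>/2 * e\<^sup>2 * (C\<^sup>2 + S\<^sup>2)"
        unfolding h using e by (simp add: power2_eq_square field_simps)
      then have "\<xi> / 2 = (a * c + b * d) / r\<^sup>2" using cs er r by simp
      moreover have "C = d / r" "S = - c / r" using h(3,4) er r by simp_all
      ultimately show ?R unfolding ecs[symmetric] using er by blast
    next
      assume ?R
      then have h: "e = r" "C = d / r" "S = - c / r" "\<xi> / 2 = (a * c + b * d) / r\<^sup>2"
        unfolding ecs by blast+
      have "a * r\<^sup>2 = d + (a * c + b * d) * c"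
        unfolding r2 using det by algebra
      moreover have "b * r\<^sup>2 = - c + (a * c + b * d) * d"
        unfolding r2 using det by algebra
      ultimately have "a = (d + (a * c + b * d) * c) / r\<^sup>2" "b = (- c + (a * c + b * d) * d) / r\<^sup>2"
        using r by (simp_all add: eq_divide_eq)
      then have "a = d / r\<^sup>2 + (a * c + b * d) / r\<^sup>2 * c" "b = - c / r\<^sup>2 + (a * c + b * d) / r\<^sup>2 * d"
        by (metis add_divide_distrib times_divide_eq_left)+
      then show ?L unfolding L h using r
        by (simp add: power2_eq_square)
    qed
  qed
  have "(d / r)\<^sup>2 + (- c / r)\<^sup>2 = 1"
    using pos r2 by (auto simp add: power_divide add_divide_distrib[symmetric] add.commute)
  then obtain x where x: "0 \<le> x" "x < 2 * pi" "d / r = cos x" "- c / r = sin x"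
    using sincos_total_2pi[of "d / r" "- c / r"] by metis
  have uniq: "\<theta> / 2 = x" if "0 \<le> \<theta>" "\<theta> < 4 * pi" "cos (\<theta>/2) = d / r" "sin (\<theta>/2) = - c / r" for \<theta>
  proof -
    have "sin (\<theta>/2) = sin x \<and> cos (\<theta>/2) = cos x" using that x by simp
    then obtain k :: int where k: "\<theta>/2 = x + 2 * pi * k"
      unfolding sin_cos_eq_iff by auto
    have "2 * pi * real_of_int k < 2 * pi * 1" "2 * pi * (-1) < 2 * pi * real_of_int k"
      using that x k by linarith+
    then have "real_of_int k < 1" "- 1 < real_of_int k"
      using pi_gt_zero by (simp_all only: mult_less_cancel_left_pos mult_pos_pos zero_less_numeral)
    then have "k = 0" by linarith
    then show ?thesis using k by simp
  qed
  show ?thesis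
  proof (rule ex1I[of _ "(2 * ((a * c + b * d) / r\<^sup>2), - 2 * ln r, 2 * x)"])
    show "case (2 * ((a * c + b * d) / r\<^sup>2), - 2 * ln r, 2 * x) of (\<xi>, t, \<theta>) \<Rightarrow>
      0 \<le> \<theta> \<and> \<theta> < 4 * pi \<and> g = n_mat \<xi> ** a_mat t ** u_mat \<theta>"
      using x r by (simp add: eq_iff)
  next
    fix p assume "case p of (\<xi>, t, \<theta>) \<Rightarrow>
      0 \<le> \<theta> \<and> \<theta> < 4 * pi \<and> g = n_mat \<xi> ** a_mat t ** u_mat \<theta>"
    then obtain \<xi> t \<theta> where p: "p = (\<xi>, t, \<theta>)" "0 \<le> \<theta>" "\<theta> < 4 * pi"
      and h: "exp (-t/2) = r" "cos (\<theta>/2) = d / r" "sin (\<theta>/2) = - c / r"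
        "\<xi> / 2 = (a * c + b * d) / r\<^sup>2"
      by (auto simp: eq_iff)
    have "ln r = - t / 2" using h(1) by (metis ln_exp)
    with p uniq[OF p(2,3) h(2,3)] h(4)
    show "p = (2 * ((a * c + b * d) / r\<^sup>2), - 2 * ln r, 2 * x)" by auto
  qed
qed


section \<open>Spherical functions\<close>

definition alpha :: "complex \<Rightarrow> real^2^2 \<Rightarrow> complex" where
  "alpha s g = (case iwasawa g of (\<xi>, t, \<theta>) \<Rightarrow> exp (s * of_real t))"

text \<open>The index ranges over the half-integers, represented as the reals \<open>n\<close> with \<open>2 * n \<in> \<int>\<close>.\<close>

definition chi :: "real \<Rightarrow> real^2^2 \<Rightarrow> complex" where
  "chi n g = (case iwasawa g of (\<xi>, t, \<theta>) \<Rightarrow> exp (\<i> * of_real (n * \<theta>)))"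

definition zeta_sph :: "real \<Rightarrow> complex \<Rightarrow> real^2^2 \<Rightarrow> complex" where
  "zeta_sph n s x = 1 / (4 * of_real pi) *
     integral {0..4 * pi}
       (\<lambda>\<theta>. alpha s (u_mat \<theta> ** x) * chi n (u_mat \<theta> ** x) * exp (- \<i> * of_real (n * \<theta>)))"


section \<open>Bessel functions\<close>

text \<open>The power series of the Bessel function of the first kind of real order. It is only
  meaningful for \<open>x > 0\<close>: because of \<open>0 powr 0 = 0\<close> it does not give the value of \<open>J\<^sub>0\<close> at 0.\<close>

definition bessel_J :: "real \<Rightarrow> real \<Rightarrow> real" where
  "bessel_J \<tau> x =
     (\<Sum>k. (-1) ^ k / (fact k * Gamma (\<tau> + real k + 1)) * (x / 2) powr (2 * real k + \<tau>))"

definition cal_J_punctured :: "real \<Rightarrow> real \<Rightarrow> real" where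
  "cal_J_punctured \<tau> z =
     bessel_J \<tau> \<bar>z\<bar> / \<bar>z\<bar> powr \<tau> * 2 powr (\<tau> - 1) * Gamma (\<tau> + 1/2)"

definition cal_J :: "real \<Rightarrow> real \<Rightarrow> real" where
  "cal_J \<tau> z = (if z = 0 then Lim (at 0) (cal_J_punctured \<tau>) else cal_J_punctured \<tau> z)"


definition sqrt_t_over_sinh :: "real \<Rightarrow> real" where
  "sqrt_t_over_sinh t = (if t = 0 then 1 else sqrt (t / sinh t))"

end

theory Submission
  imports Defs
begin

text \<open>
  Put w = cosh (t/2) - sinh (t/2) exp (-i \<theta>). Reading off the Iwasawa coordinates of
  u(\<theta>) a(t) from its lower row shows that \<zeta>(a(t)) is the mean over the circle of
  |w|^(-2s) (w/|w|)^(2n), and conjugation symmetry turns this into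
  (1/\<pi>) times the integral over [0,\<pi>] of |w|^(-2s) cos (2n \<psi>), where \<psi> is the
  argument of w. For s = 1/2 + i\<lambda> substitute |w|^2 = exp u with u = t sin \<phi>: one gets
  (t / sinh t)^(1/2) / \<pi> times the integral over [-\<pi>/2,\<pi>/2] of
  cos (\<lambda> t sin \<phi>) F(t^2 cos^2 \<phi>), with an amplitude F that depends on u only through
  v = t^2 - u^2 (lemma \<open>zeta_sph_eq_profile_integral\<close>; F is called \<open>profile\<close>).

  The amplitude satisfies F(0) = 1, and its k-th derivative on [0,t^2] is O((1+|n|)^(2k)) for k up to 3,
  uniformly in 0 < t \<le> 1 (lemma \<open>smooth3_profile\<close>). Indeed cosh t - cosh u and \<psi>^2 are
  smooth functions of v with bounds that do not involve n. The index n enters only through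
  cos (2n \<psi>) = C(4 n^2 \<psi>^2), where C(x) = cos \<surd>x is entire with all derivatives bounded by 1
  on x \<ge> 0; so each derivative in v costs a factor of size n^2. This works alike for integers and
  half-integers.

  Expand F at v = 0 to second order. By Poisson's integral the term v^j contributes
  2/\<surd>\<pi> times t^(2j) times the normalised Bessel function of order j at \<lambda> t; hence b_0 = 2/\<surd>\<pi>,
  b_1 = (2/\<surd>\<pi>) F'(0) and b_2 = F''(0)/\<surd>\<pi>, of sizes O(1), O((1+|n|)^2), O((1+|n|)^4).
  The remainder H has |H^(k)(v)| \<le> B v^(3-k) with B = O((1+|n|)^6). In the variable u the weight is
  H(t^2-u^2) (t^2-u^2)^(-1/2), which vanishes at u = \<plusminus>t together with two derivatives and
  whose third derivative is O(B (t^2-u^2)^(-1/2)), an integrable function. Three integrations by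
  parts therefore give E = O(B \<lambda>^(-3)) (lemma \<open>oscillatory_integral_bound\<close>), and
  \<lambda> \<cdot> \<lambda>^(-3) is integrable on [1,\<infinity>). At t = 0 the error vanishes identically,
  because b_0 times the value \<surd>\<pi>/2 of the normalised J_0 at 0 is 1 = \<zeta>(a(0)).
\<close>

section \<open>The entire function cos of square root\<close>

definition cosqrt_coeff :: "nat \<Rightarrow> nat \<Rightarrow> real" where
  "cosqrt_coeff k m = (-1) ^ (m + k) * fact (m + k) / (fact m * fact (2 * (m + k)))"

text \<open>
  The \<open>k\<close>-th derivative of the entire function equal to cos \<surd>x for x \<ge> 0 and to
  cosh \<surd>(-x) for x \<le> 0. It converts even functions of t, u or \<psi> into functions of their squares.
\<close>

definition cosqrt :: "nat \<Rightarrow> real \<Rightarrow> real" where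
  "cosqrt k x = (\<Sum>m. cosqrt_coeff k m * x ^ m)"

lemma abs_cosqrt_coeff_le: "\<bar>cosqrt_coeff k m\<bar> \<le> inverse (fact m)"
proof -
  have "fact (m + k) / fact (2 * (m + k)) \<le> (1::real)"
    by (simp add: fact_mono)
  then have "fact (m + k) / fact (2 * (m + k)) / fact m \<le> 1 / (fact m :: real)"
    by (intro divide_right_mono) auto
  then show ?thesis
    by (simp add: cosqrt_coeff_def abs_mult power_abs field_simps)
qed

text \<open>
  The exponential series dominates for every k at once, which gives a bound on negative arguments,
  where the functions grow.
\<close>

lemma summable_cosqrt: "summable (\<lambda>m. cosqrt_coeff k m * x ^ m)"
  and abs_cosqrt_le_exp: "\<bar>cosqrt k x\<bar> \<le> exp \<bar>x\<bar>"
proof -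
  have le: "norm (cosqrt_coeff k m * x ^ m) \<le> inverse (fact m) * \<bar>x\<bar> ^ m" for m
    using abs_cosqrt_coeff_le[of k m] by (simp add: abs_mult power_abs mult_right_mono)
  have s: "summable (\<lambda>m. inverse (fact m) * \<bar>x\<bar> ^ m)"
    using summable_exp[of "\<bar>x\<bar>"] .
  show "summable (\<lambda>m. cosqrt_coeff k m * x ^ m)"
    using summable_comparison_test'[OF s le] .
  have "norm (\<Sum>m. cosqrt_coeff k m * x ^ m) \<le> (\<Sum>m. inverse (fact m) * \<bar>x\<bar> ^ m)"
    using norm_suminf_le[OF le s] by blast
  also have "\<dots> = exp \<bar>x\<bar>"
    by (simp add: exp_def scaleR_conv_of_real)
  finally show "\<bar>cosqrt k x\<bar> \<le> exp \<bar>x\<bar>"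
    by (simp add: cosqrt_def)
qed

lemma diffs_cosqrt_coeff: "diffs (cosqrt_coeff k) = cosqrt_coeff (Suc k)"
proof
  fix m
  have "Suc m + k = m + Suc k" by simp
  then show "diffs (cosqrt_coeff k) m = cosqrt_coeff (Suc k) m"
    unfolding diffs_def cosqrt_coeff_def by (simp only:) (simp add: divide_simps)
qed

lemma DERIV_cosqrt: "(cosqrt k has_real_derivative cosqrt (Suc k) x) (at x)"
  unfolding cosqrt_def diffs_cosqrt_coeff[symmetric]
  by (rule termdiffs_strong_converges_everywhere) (rule summable_cosqrt)

lemma DERIV_cosqrt_chain [derivative_intros]:
  "(f has_real_derivative d) (at x within S) \<Longrightarrow>
    ((\<lambda>x. cosqrt k (f x)) has_real_derivative cosqrt (Suc k) (f x) * d) (at x within S)"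
  by (rule DERIV_chain2[OF DERIV_cosqrt])

lemma continuous_on_cosqrt [continuous_intros]:
  "continuous_on S f \<Longrightarrow> continuous_on S (\<lambda>x. cosqrt k (f x))"
  by (rule continuous_on_compose2[of UNIV "cosqrt k"])
    (auto intro!: DERIV_continuous_on[OF DERIV_cosqrt])

lemma cosqrt_square: "cosqrt 0 (x\<^sup>2) = cos x"
  and cosqrt_neg_square: "cosqrt 0 (- x\<^sup>2) = cosh x"
proof -
  have "(\<lambda>m. (-1) ^ m / fact (2 * m) * x ^ (2 * m)) sums cos x"
    using cos_paired .
  then show "cosqrt 0 (x\<^sup>2) = cos x"
    by (simp add: cosqrt_def cosqrt_coeff_def sums_iff power_mult)
  have "(\<lambda>m. if even m then x ^ m /\<^sub>R fact m else 0) sums cosh x"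
    by (rule cosh_converges)
  then have "(\<lambda>m. x ^ (2 * m) /\<^sub>R fact (2 * m)) sums cosh x"
    by (subst (asm) sums_mono_reindex[of "\<lambda>m. 2 * m", symmetric])
      (auto simp: strict_mono_def image_def elim!: evenE)
  then have "(\<lambda>m. x ^ (2 * m) / fact (2 * m)) sums cosh x"
    by (simp add: field_simps)
  moreover have "cosqrt_coeff 0 m * (- x\<^sup>2) ^ m = x ^ (2 * m) / fact (2 * m)" for m
  proof -
    have "(-1) ^ m * (- x\<^sup>2) ^ m = x ^ (2 * m)"
      by (simp flip: power_mult_distrib power_mult)
    then show ?thesis
      by (simp add: cosqrt_coeff_def)
  qed
  ultimately show "cosqrt 0 (- x\<^sup>2) = cosh x"
    by (simp add: cosqrt_def sums_iff)
qed

lemma sin_eq_cosqrt: "sin x = - 2 * x * cosqrt 1 (x\<^sup>2)"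
proof -
  have "((\<lambda>x. cosqrt 0 (x\<^sup>2)) has_real_derivative cosqrt 1 (x\<^sup>2) * (2 * x)) (at x)"
    by (rule derivative_eq_intros refl)+ simp
  moreover have "((\<lambda>x. cosqrt 0 (x\<^sup>2)) has_real_derivative - sin x) (at x)"
    unfolding cosqrt_square by (auto intro!: derivative_eq_intros)
  ultimately have "cosqrt 1 (x\<^sup>2) * (2 * x) = - sin x"
    by (rule DERIV_unique)
  then show ?thesis by algebra
qed

lemma sinh_eq_cosqrt: "sinh x = - 2 * x * cosqrt 1 (- x\<^sup>2)"
proof -
  have "((\<lambda>x. cosqrt 0 (- x\<^sup>2)) has_real_derivative cosqrt 1 (- x\<^sup>2) * (- 2 * x)) (at x)"
    by (rule derivative_eq_intros refl)+ simp
  moreover have "((\<lambda>x. cosqrt 0 (- x\<^sup>2)) has_real_derivative sinh x) (at x)"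
    unfolding cosqrt_neg_square by (auto intro!: derivative_eq_intros)
  ultimately have "cosqrt 1 (- x\<^sup>2) * (- 2 * x) = sinh x"
    by (rule DERIV_unique)
  then show ?thesis by (simp add: mult.commute)
qed

text \<open>
  This is the k-th derivative of the equation 4 x C'' + 2 C' + C = 0 satisfied by C(x) = cos \<surd>x.
\<close>

lemma cosqrt_ode: "(4 * real k + 2) * cosqrt (Suc k) x + 4 * x * cosqrt (Suc (Suc k)) x = - cosqrt k x"
proof -
  have coeff: "(4 * real k + 2) * cosqrt_coeff (Suc k) m + 4 * (real m * cosqrt_coeff (Suc k) m)
      = - cosqrt_coeff k m" for m
  proof -
    define p where "p = m + k"
    have "fact (2 * Suc p) = (2 * (1 + real p)) * ((2 * real p + 1) * fact (2 * p))"
      by (simp add: algebra_simps)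
    moreover have "fact (Suc p) = (1 + real p) * fact p" by simp
    ultimately have "cosqrt_coeff (Suc k) m = - ((-1) ^ p * ((1 + real p) * fact p)) /
        (fact m * ((2 * (1 + real p)) * ((2 * real p + 1) * fact (2 * p))))"
      unfolding cosqrt_coeff_def p_def by (simp only: add_Suc_right power_Suc)
    also have "\<dots> = ((1 + real p) * - ((-1) ^ p * fact p)) /
        ((1 + real p) * ((2 * (2 * real p + 1)) * (fact m * fact (2 * p))))"
      by (simp only: mult_ac mult_minus_right)
    also have "\<dots> = - ((-1) ^ p * fact p) / ((2 * (2 * real p + 1)) * (fact m * fact (2 * p)))"
      by (rule mult_divide_mult_cancel_left) linarith
    also have "\<dots> = - cosqrt_coeff k m / (2 * (2 * real p + 1))"
      unfolding cosqrt_coeff_def p_def by (simp only: mult_ac divide_divide_eq_left minus_divide_left)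
    finally have "(2 * (2 * real p + 1)) * cosqrt_coeff (Suc k) m = - cosqrt_coeff k m"
      by (simp add: field_simps del: of_nat_add)
    then show ?thesis by (simp add: p_def algebra_simps)
  qed
  have "(\<lambda>m. of_nat m * cosqrt_coeff (Suc k) m * x ^ (m - Suc 0)) sums cosqrt (Suc (Suc k)) x"
    using diffs_equiv[of "cosqrt_coeff (Suc k)" x] summable_cosqrt[of "Suc (Suc k)" x]
    by (simp add: diffs_cosqrt_coeff cosqrt_def)
  then have "(\<lambda>m. (4 * x) * (of_nat m * cosqrt_coeff (Suc k) m * x ^ (m - Suc 0)))
      sums (4 * x * cosqrt (Suc (Suc k)) x)"
    by (rule sums_mult)
  moreover have "(4 * x) * (of_nat m * cosqrt_coeff (Suc k) m * x ^ (m - Suc 0))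
      = 4 * (real m * cosqrt_coeff (Suc k) m) * x ^ m" for m
    by (cases m) auto
  ultimately have 1: "(\<lambda>m. 4 * (real m * cosqrt_coeff (Suc k) m) * x ^ m)
      sums (4 * x * cosqrt (Suc (Suc k)) x)"
    by simp
  have 2: "(\<lambda>m. (4 * real k + 2) * (cosqrt_coeff (Suc k) m * x ^ m))
      sums ((4 * real k + 2) * cosqrt (Suc k) x)"
    using summable_cosqrt[THEN summable_sums] unfolding cosqrt_def by (rule sums_mult)
  have "(\<lambda>m. ((4 * real k + 2) * cosqrt_coeff (Suc k) m + 4 * (real m * cosqrt_coeff (Suc k) m)) * x ^ m)
      sums ((4 * real k + 2) * cosqrt (Suc k) x + 4 * x * cosqrt (Suc (Suc k)) x)"
    using sums_add[OF 2 1] by (simp add: algebra_simps)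
  then have "(\<lambda>m. - (cosqrt_coeff k m * x ^ m))
      sums ((4 * real k + 2) * cosqrt (Suc k) x + 4 * x * cosqrt (Suc (Suc k)) x)"
    by (simp add: coeff)
  moreover have "(\<lambda>m. - (cosqrt_coeff k m * x ^ m)) sums (- cosqrt k x)"
    using summable_cosqrt[THEN summable_sums, THEN sums_minus] unfolding cosqrt_def .
  ultimately show ?thesis
    using sums_unique2 by blast
qed

text \<open>
  By the differential equation, r^(2k+1) C^(k+1)(r^2) has derivative -(1/2) r^(2k) C^(k)(r^2); so a bound
  for C^(k) on the half line passes to C^(k+1) by integration from 0, where the left side vanishes.
\<close>

lemma abs_cosqrt_le_1: "x \<ge> 0 \<Longrightarrow> \<bar>cosqrt k x\<bar> \<le> 1"
proof (induction k arbitrary: x)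
  case 0
  then show ?case using cosqrt_square[of "sqrt x"] by simp
next
  case (Suc k)
  \<comment> \<open>The integrating factor for cosqrt_ode in the variable r with x = r^2.\<close>
  define h where "h r = r ^ (2 * k + 1) * cosqrt (Suc k) (r\<^sup>2)" for r
  have h': "(h has_real_derivative - (1/2) * r ^ (2 * k) * cosqrt k (r\<^sup>2)) (at r)" for r
  proof -
    have "(h has_real_derivative (2 * real k + 1) * r ^ (2 * k) * cosqrt (Suc k) (r\<^sup>2)
        + cosqrt (Suc (Suc k)) (r\<^sup>2) * (2 * r) * r ^ (2 * k + 1)) (at r)"
      unfolding h_def by (rule derivative_eq_intros refl)+ simp
    also have "(2 * real k + 1) * r ^ (2 * k) * cosqrt (Suc k) (r\<^sup>2)
        + cosqrt (Suc (Suc k)) (r\<^sup>2) * (2 * r) * r ^ (2 * k + 1)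
        = (1/2) * r ^ (2 * k) * ((4 * real k + 2) * cosqrt (Suc k) (r\<^sup>2)
            + 4 * r\<^sup>2 * cosqrt (Suc (Suc k)) (r\<^sup>2))"
      by (simp add: field_simps power2_eq_square)
    finally show ?thesis by (simp add: cosqrt_ode)
  qed
  define m where "m = real (2 * k + 1)"
  have m: "m \<ge> 1" by (simp add: m_def)
  have pw: "((\<lambda>r. r ^ (2 * k + 1) / m) has_real_derivative r ^ (2 * k)) (at r)" for r
  proof -
    have "((\<lambda>r. r ^ (2 * k + 1)) has_real_derivative m * r ^ (2 * k)) (at r)"
      unfolding m_def by (rule derivative_eq_intros refl)+ simp
    from DERIV_cdivide[OF this, of m] show ?thesis using m by simp
  qed
  have le: "\<bar>h r\<bar> \<le> r ^ (2 * k + 1) / m" if r: "r \<ge> 0" for r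
  proof -
    have b: "\<bar>cosqrt k (s\<^sup>2)\<bar> \<le> 1" for s by (rule Suc.IH) simp
    have b': "\<bar>1/2 * s ^ (2 * k) * cosqrt k (s\<^sup>2)\<bar> \<le> s ^ (2 * k)" for s
    proof -
      have "s ^ (2 * k) \<ge> 0" by simp
      moreover have "\<bar>s ^ (2 * k) * cosqrt k (s\<^sup>2)\<bar> \<le> s ^ (2 * k) * 1"
        unfolding abs_mult using b[of s] \<open>s ^ (2 * k) \<ge> 0\<close>
        by (intro mult_mono) auto
      moreover have "\<bar>1/2 * s ^ (2 * k) * cosqrt k (s\<^sup>2)\<bar> = 1/2 * \<bar>s ^ (2 * k) * cosqrt k (s\<^sup>2)\<bar>"
        by (simp add: abs_mult)
      ultimately show ?thesis by linarith
    qed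
    have "0 ^ (2 * k + 1) / m - h 0 \<le> r ^ (2 * k + 1) / m - h r"
    proof (rule DERIV_nonneg_imp_nondecreasing[OF r])
      fix s
      show "\<exists>y. ((\<lambda>r. r ^ (2 * k + 1) / m - h r) has_real_derivative y) (at s) \<and> 0 \<le> y"
        using DERIV_diff[OF pw h', of s] b'[of s] by (intro exI conjI) auto
    qed
    moreover have "0 ^ (2 * k + 1) / m + h 0 \<le> r ^ (2 * k + 1) / m + h r"
    proof (rule DERIV_nonneg_imp_nondecreasing[OF r])
      fix s
      show "\<exists>y. ((\<lambda>r. r ^ (2 * k + 1) / m + h r) has_real_derivative y) (at s) \<and> 0 \<le> y"
        using DERIV_add[OF pw h', of s] b'[of s] by (intro exI conjI) auto
    qed
    ultimately show ?thesis by (simp add: h_def)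
  qed
  show ?case
  proof (cases "x = 0")
    case True
    have "\<bar>cosqrt_coeff (Suc k) 0\<bar> \<le> 1"
      using abs_cosqrt_coeff_le[of "Suc k" 0] by simp
    then show ?thesis by (simp add: True cosqrt_def powser_zero)
  next
    case False
    define r where "r = sqrt x"
    have r: "r > 0" "r\<^sup>2 = x" using False Suc.prems by (simp_all add: r_def)
    have "r ^ (2 * k + 1) * \<bar>cosqrt (Suc k) x\<bar> \<le> r ^ (2 * k + 1) / m"
      using le[of r] r by (simp add: h_def abs_mult)
    also have "\<dots> \<le> r ^ (2 * k + 1) * 1"
      using m r by (simp add: divide_le_eq)
    finally show ?thesis using r by (simp only: mult_le_cancel_left_pos zero_less_power)
  qed
qed

section \<open>Functions with three bounded derivatives\<close>

text \<open>
  The function has three derivatives on S (one-sided at boundary points), with size M, and every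
  derivative costs a factor N. Keeping M and N apart is what tracks the power of the index n.
\<close>

definition smooth3 :: "real set \<Rightarrow> real \<Rightarrow> real \<Rightarrow> (real \<Rightarrow> real) \<Rightarrow> bool" where
  "smooth3 S M N f \<longleftrightarrow> (\<exists>f1 f2 f3. \<forall>x\<in>S.
      (f has_real_derivative f1 x) (at x within S) \<and>
      (f1 has_real_derivative f2 x) (at x within S) \<and>
      (f2 has_real_derivative f3 x) (at x within S) \<and>
      \<bar>f x\<bar> \<le> M \<and> \<bar>f1 x\<bar> \<le> M * N \<and> \<bar>f2 x\<bar> \<le> M * N ^ 2 \<and> \<bar>f3 x\<bar> \<le> M * N ^ 3)"

lemma smooth3E:
  assumes "smooth3 S M N f"
  obtains f1 f2 f3 where
    "\<And>x. x \<in> S \<Longrightarrow> (f has_real_derivative f1 x) (at x within S)"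
    "\<And>x. x \<in> S \<Longrightarrow> (f1 has_real_derivative f2 x) (at x within S)"
    "\<And>x. x \<in> S \<Longrightarrow> (f2 has_real_derivative f3 x) (at x within S)"
    "\<And>x. x \<in> S \<Longrightarrow> \<bar>f x\<bar> \<le> M" "\<And>x. x \<in> S \<Longrightarrow> \<bar>f1 x\<bar> \<le> M * N"
    "\<And>x. x \<in> S \<Longrightarrow> \<bar>f2 x\<bar> \<le> M * N ^ 2" "\<And>x. x \<in> S \<Longrightarrow> \<bar>f3 x\<bar> \<le> M * N ^ 3"
  using assms unfolding smooth3_def by (elim exE) (rule that; blast)

lemma abs_mult_le: "\<bar>a\<bar> \<le> A \<Longrightarrow> \<bar>b\<bar> \<le> B \<Longrightarrow> \<bar>a * b\<bar> \<le> A * (B::real)"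
  unfolding abs_mult by (rule mult_mono) auto

lemma smooth3_mult:
  assumes "smooth3 S M N f" "smooth3 S L N g" "M \<ge> 0" "L \<ge> 0" "N \<ge> 0"
  shows "smooth3 S (8 * (M * L)) N (\<lambda>x. f x * g x)"
proof -
  obtain f1 f2 f3 where f:
    "\<And>x. x \<in> S \<Longrightarrow> (f has_real_derivative f1 x) (at x within S)"
    "\<And>x. x \<in> S \<Longrightarrow> (f1 has_real_derivative f2 x) (at x within S)"
    "\<And>x. x \<in> S \<Longrightarrow> (f2 has_real_derivative f3 x) (at x within S)"
    and fb: "\<And>x. x \<in> S \<Longrightarrow> \<bar>f x\<bar> \<le> M" "\<And>x. x \<in> S \<Longrightarrow> \<bar>f1 x\<bar> \<le> M * N"
    "\<And>x. x \<in> S \<Longrightarrow> \<bar>f2 x\<bar> \<le> M * N ^ 2" "\<And>x. x \<in> S \<Longrightarrow> \<bar>f3 x\<bar> \<le> M * N ^ 3"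
    by (rule smooth3E[OF assms(1)]) (rule that; assumption)
  obtain g1 g2 g3 where g:
    "\<And>x. x \<in> S \<Longrightarrow> (g has_real_derivative g1 x) (at x within S)"
    "\<And>x. x \<in> S \<Longrightarrow> (g1 has_real_derivative g2 x) (at x within S)"
    "\<And>x. x \<in> S \<Longrightarrow> (g2 has_real_derivative g3 x) (at x within S)"
    and gb: "\<And>x. x \<in> S \<Longrightarrow> \<bar>g x\<bar> \<le> L" "\<And>x. x \<in> S \<Longrightarrow> \<bar>g1 x\<bar> \<le> L * N"
    "\<And>x. x \<in> S \<Longrightarrow> \<bar>g2 x\<bar> \<le> L * N ^ 2" "\<And>x. x \<in> S \<Longrightarrow> \<bar>g3 x\<bar> \<le> L * N ^ 3"
    by (rule smooth3E[OF assms(2)]) (rule that; assumption)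
  show ?thesis
    unfolding smooth3_def
  proof (intro exI ballI conjI)
    fix x assume x: "x \<in> S"
    show "((\<lambda>x. f x * g x) has_real_derivative f1 x * g x + f x * g1 x) (at x within S)"
      using x by (auto intro!: derivative_eq_intros f g)
    show "((\<lambda>x. f1 x * g x + f x * g1 x) has_real_derivative
        f2 x * g x + 2 * (f1 x * g1 x) + f x * g2 x) (at x within S)"
      using x by (auto intro!: derivative_eq_intros f g)
    show "((\<lambda>x. f2 x * g x + 2 * (f1 x * g1 x) + f x * g2 x) has_real_derivative
        f3 x * g x + 3 * (f2 x * g1 x) + 3 * (f1 x * g2 x) + f x * g3 x) (at x within S)"
      using x by (auto intro!: derivative_eq_intros f g)
    note b = fb[OF x] gb[OF x]
    have nn: "0 \<le> M * L * N ^ k" for k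
      using assms by auto
    have e: "M * N ^ i * (L * N ^ j) = M * L * N ^ (i + j)" for i j
      by (simp add: power_add)
    have b': "\<bar>f x\<bar> \<le> M * N ^ 0" "\<bar>f1 x\<bar> \<le> M * N ^ 1" "\<bar>g x\<bar> \<le> L * N ^ 0" "\<bar>g1 x\<bar> \<le> L * N ^ 1"
      using b by auto
    note p = abs_mult_le[where A = "M * N ^ i" and B = "L * N ^ j" for i j, unfolded e]
    show "\<bar>f x * g x\<bar> \<le> 8 * (M * L)"
      using p[OF b'(1,3)] nn[of 0] by simp
    show "\<bar>f1 x * g x + f x * g1 x\<bar> \<le> 8 * (M * L) * N"
      using p[OF b'(2,3)] p[OF b'(1,4)] nn[of 1] by (simp add: abs_if split: if_splits)
    show "\<bar>f2 x * g x + 2 * (f1 x * g1 x) + f x * g2 x\<bar> \<le> 8 * (M * L) * N\<^sup>2"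
      using p[OF b(3) b'(3)] p[OF b'(2,4)] p[OF b'(1) b(7)] nn[of 2]
      by (simp add: numeral_2_eq_2[symmetric] del: power_Suc)
    show "\<bar>f3 x * g x + 3 * (f2 x * g1 x) + 3 * (f1 x * g2 x) + f x * g3 x\<bar> \<le> 8 * (M * L) * N ^ 3"
      using p[OF b(4) b'(3)] p[OF b(3) b'(4)] p[OF b'(2) b(7)] p[OF b'(1) b(8)] nn[of 3]
      by (simp add: numeral_3_eq_3[symmetric] numeral_2_eq_2[symmetric] del: power_Suc)
  qed
qed

text \<open>
  Only the outer function carries the scale N, so by the chain rule each derivative of the composite
  still costs one factor N: the term with j outer derivatives has N^j with j at most the order.
\<close>

lemma smooth3_compose:
  assumes "smooth3 T M N g" "smooth3 S L 1 h" "h ` S \<subseteq> T" "M \<ge> 0" "L \<ge> 1" "N \<ge> 1"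
  shows "smooth3 S (5 * (M * L ^ 3)) N (\<lambda>x. g (h x))"
proof -
  obtain g1 g2 g3 where g:
    "\<And>x. x \<in> T \<Longrightarrow> (g has_real_derivative g1 x) (at x within T)"
    "\<And>x. x \<in> T \<Longrightarrow> (g1 has_real_derivative g2 x) (at x within T)"
    "\<And>x. x \<in> T \<Longrightarrow> (g2 has_real_derivative g3 x) (at x within T)"
    and gb: "\<And>x. x \<in> T \<Longrightarrow> \<bar>g x\<bar> \<le> M" "\<And>x. x \<in> T \<Longrightarrow> \<bar>g1 x\<bar> \<le> M * N"
    "\<And>x. x \<in> T \<Longrightarrow> \<bar>g2 x\<bar> \<le> M * N ^ 2" "\<And>x. x \<in> T \<Longrightarrow> \<bar>g3 x\<bar> \<le> M * N ^ 3"
    by (rule smooth3E[OF assms(1)]) (rule that; assumption)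
  obtain h1 h2 h3 where h:
    "\<And>x. x \<in> S \<Longrightarrow> (h has_real_derivative h1 x) (at x within S)"
    "\<And>x. x \<in> S \<Longrightarrow> (h1 has_real_derivative h2 x) (at x within S)"
    "\<And>x. x \<in> S \<Longrightarrow> (h2 has_real_derivative h3 x) (at x within S)"
    and hb: "\<And>x. x \<in> S \<Longrightarrow> \<bar>h x\<bar> \<le> L" "\<And>x. x \<in> S \<Longrightarrow> \<bar>h1 x\<bar> \<le> L"
    "\<And>x. x \<in> S \<Longrightarrow> \<bar>h2 x\<bar> \<le> L" "\<And>x. x \<in> S \<Longrightarrow> \<bar>h3 x\<bar> \<le> L"
    by (rule smooth3E[OF assms(2), unfolded mult_1_right power_one]) (rule that; assumption)
  have chain: "((\<lambda>x. G (h x)) has_real_derivative G' (h x) * h1 x) (at x within S)"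
    if "\<And>y. y \<in> T \<Longrightarrow> (G has_real_derivative G' y) (at y within T)" "x \<in> S" for G G' x
  proof -
    have "(G has_real_derivative G' (h x)) (at (h x) within h ` S)"
      using that assms(3) by (auto intro: has_field_derivative_subset)
    from DERIV_image_chain[OF this h(1)[OF that(2)]] show ?thesis by (simp add: o_def)
  qed
  note gh = chain[OF g(1)] chain[OF g(2)] chain[OF g(3)]
  have L: "L \<le> L ^ 3" "L ^ 2 \<le> L ^ 3" "1 \<le> L ^ 3"
    using assms(5) power_increasing[of 1 3 L] power_increasing[of 2 3 L] by (auto intro: one_le_power)
  have N: "N \<le> N ^ 2" "N \<le> N ^ 3" "N ^ 2 \<le> N ^ 3"
    using assms(6) power_increasing[of 1 3 N] power_increasing[of 1 2 N] power_increasing[of 2 3 N] by auto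
  show ?thesis
    unfolding smooth3_def
  proof (intro exI ballI conjI)
    fix x assume x: "x \<in> S"
    show "((\<lambda>x. g (h x)) has_real_derivative g1 (h x) * h1 x) (at x within S)"
      using gh x by auto
    show "((\<lambda>x. g1 (h x) * h1 x) has_real_derivative
        g2 (h x) * (h1 x * h1 x) + g1 (h x) * h2 x) (at x within S)"
      using x by (auto intro!: derivative_eq_intros gh h)
    show "((\<lambda>x. g2 (h x) * (h1 x * h1 x) + g1 (h x) * h2 x) has_real_derivative
        g3 (h x) * (h1 x * h1 x * h1 x) + 3 * (g2 (h x) * (h1 x * h2 x)) + g1 (h x) * h3 x) (at x within S)"
      using x by (auto intro!: derivative_eq_intros gh h simp: algebra_simps)
    have "h x \<in> T" using x assms(3) by auto
    note b = gb[OF this] and c = hb[OF x]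
    have up: "\<bar>p * q\<bar> \<le> M * L ^ 3 * N ^ k"
      if "\<bar>p\<bar> \<le> M * P" "\<bar>q\<bar> \<le> Q" "P \<le> N ^ k" "Q \<le> L ^ 3" "P \<ge> 0" for p q P Q k
    proof -
      have "Q \<ge> 0" using that(2) by linarith
      have "\<bar>p * q\<bar> \<le> (M * P) * Q" by (rule abs_mult_le) fact+
      also have "\<dots> \<le> (M * N ^ k) * L ^ 3"
        using that \<open>Q \<ge> 0\<close> assms by (intro mult_mono mult_left_mono) auto
      finally show ?thesis by (simp add: mult_ac)
    qed
    have q2: "\<bar>h1 x * h1 x\<bar> \<le> L ^ 2" "\<bar>h1 x * h2 x\<bar> \<le> L ^ 2"
      using abs_mult_le[OF c(2) c(2)] abs_mult_le[OF c(2) c(3)] by (simp_all only: power2_eq_square)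
    have q3: "\<bar>h1 x * h1 x * h1 x\<bar> \<le> L ^ 3"
      using abs_mult_le[OF q2(1) c(2)] by (simp add: power3_eq_cube power2_eq_square)
    have nn: "0 \<le> M * L ^ 3 * N ^ k" for k
      using assms by auto
    have b1: "\<bar>g1 (h x)\<bar> \<le> M * N ^ 1" using b by simp
    have "M * 1 \<le> M * L ^ 3" using L assms by (intro mult_left_mono) auto
    then show "\<bar>g (h x)\<bar> \<le> 5 * (M * L ^ 3)"
      using b(1) nn[of 0] by simp
    show "\<bar>g1 (h x) * h1 x\<bar> \<le> 5 * (M * L ^ 3) * N"
      using up[OF b1 c(2), of 1] L N nn[of 1] assms by simp
    show "\<bar>g2 (h x) * (h1 x * h1 x) + g1 (h x) * h2 x\<bar> \<le> 5 * (M * L ^ 3) * N\<^sup>2"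
      using up[OF b(3) q2(1), of 2] up[OF b1 c(3), of 2] L N nn[of 2] assms
      by simp
    show "\<bar>g3 (h x) * (h1 x * h1 x * h1 x) + 3 * (g2 (h x) * (h1 x * h2 x)) + g1 (h x) * h3 x\<bar>
        \<le> 5 * (M * L ^ 3) * N ^ 3"
      using up[OF b(4) q3, of 3] up[OF b(3) q2(2), of 3] up[OF b1 c(4), of 3] L N nn[of 3] assms
      by simp
  qed
qed

text \<open>
  A continuous extension of the derivative to an endpoint is the one-sided derivative there, since the
  function is the integral of that extension.
\<close>

lemma has_real_derivative_Icc_from_interior:
  fixes f g :: "real \<Rightarrow> real"
  assumes "continuous_on {a..b} f" "continuous_on {a..b} g"
    and deriv: "\<And>x. a < x \<Longrightarrow> x < b \<Longrightarrow> (f has_real_derivative g x) (at x)"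
    and x: "x \<in> {a..b}"
  shows "(f has_real_derivative g x) (at x within {a..b})"
proof -
  have eq: "f y = f a + integral {a..y} g" if "y \<in> {a..b}" for y
  proof -
    have "(g has_integral f y - f a) {a..y}"
    proof (rule fundamental_theorem_of_calculus_interior)
      show "a \<le> y" using that by simp
      show "continuous_on {a..y} f"
        using assms(1) that by (rule_tac continuous_on_subset) auto
      show "(f has_vector_derivative g z) (at z)" if "z \<in> {a<..<y}" for z
        using deriv[of z] that \<open>y \<in> {a..b}\<close> by (auto simp: has_real_derivative_iff_has_vector_derivative)
    qed
    then show ?thesis by (simp add: integral_unique)
  qed
  have "((\<lambda>y. f a + integral {a..y} g) has_real_derivative g x) (at x within {a..b})"
    using integral_has_real_derivative[OF assms(2) x] by (auto intro!: derivative_eq_intros)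
  then show ?thesis
    by (rule has_field_derivative_transform_within[where d = 1]) (use x in \<open>auto simp flip: eq\<close>)
qed

lemma smooth3_mono_scale:
  assumes "smooth3 S M N f" "N \<le> N'" "0 \<le> M" "0 \<le> N"
  shows "smooth3 S M N' f"
proof -
  have "M * N ^ k \<le> M * N' ^ k" for k
    using assms by (intro mult_left_mono power_mono) auto
  from this[of 1] this[of 2] this[of 3] show ?thesis
    using assms(1) unfolding smooth3_def power_one_right by (meson order_trans)
qed

section \<open>The building blocks of the amplitude\<close>

text \<open>
  The only place where the index n enters the estimates, with c = 4 n^2.
\<close>

lemma smooth3_cosqrt_scaled:
  assumes "0 \<le> c" "c \<le> N"
  shows "smooth3 {0..} 1 N (\<lambda>x. cosqrt 0 (c * x))"
proof -
  have b: "\<bar>c ^ k * cosqrt j (c * x)\<bar> \<le> 1 * N ^ k" if "x \<ge> 0" for k j x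
  proof -
    have "\<bar>c ^ k * cosqrt j (c * x)\<bar> \<le> N ^ k * 1"
      by (rule abs_mult_le) (use assms that in \<open>auto intro!: power_mono abs_cosqrt_le_1\<close>)
    then show ?thesis by simp
  qed
  have d: "((\<lambda>x. c ^ k * cosqrt j (c * x)) has_real_derivative c ^ Suc k * cosqrt (Suc j) (c * x))
      (at x within S)" for k j x S
    by (rule derivative_eq_intros refl)+ simp
  show ?thesis
    unfolding smooth3_def
    using d[of 0 0] d[of 1 1] d[of 2 2] b[of _ 0 0] b[of _ 1 1] b[of _ 2 2] b[of _ 3 3]
    by (intro exI[of _ "\<lambda>x. c ^ 1 * cosqrt 1 (c * x)"] exI[of _ "\<lambda>x. c ^ 2 * cosqrt 2 (c * x)"]
          exI[of _ "\<lambda>x. c ^ 3 * cosqrt 3 (c * x)"])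
      (auto simp: numeral_2_eq_2 numeral_3_eq_3)
qed

lemma smooth3_rsqrt: "smooth3 {1/2..} 30 1 (\<lambda>x. x powr (-1/2))"
proof -
  have b: "x powr (-1/2 - real k) \<le> 12" if "x \<ge> 1/2" "k \<le> 3" for x :: real and k
  proof -
    have "x powr (-1/2 - real k) \<le> (1/2) powr (-1/2 - real k)"
      using that by (intro powr_mono2') auto
    also have "\<dots> \<le> (1/2) powr (-7/2)"
      using that by (intro powr_mono') auto
    also have "\<dots> = inverse (sqrt ((1/2) ^ 7))"
      using powr_powr[of "1/2::real" 7 "1/2"] by (simp add: powr_minus powr_half_sqrt)
    also have "\<dots> \<le> inverse (1/12)"
      by (intro le_imp_inverse_le real_le_rsqrt) (simp_all add: power_divide)
    also have "\<dots> = 12" by simp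
    finally show ?thesis .
  qed
  have d: "((\<lambda>x. c * x powr (-1/2 - real k)) has_real_derivative
      c * (-1/2 - real k) * x powr (-1/2 - real (Suc k))) (at x within S)" if "x \<ge> 1/2" for x S k c
  proof -
    have "-1/2 - real k - 1 = -1/2 - real (Suc k)" by simp
    then show ?thesis
      using has_real_derivative_powr[of x "-1/2 - real k", THEN DERIV_cmult, of c] that
      by (auto intro: has_field_derivative_at_within simp: mult.assoc)
  qed
  show ?thesis
    unfolding smooth3_def
  proof (intro exI ballI conjI)
    fix x :: real assume x: "x \<in> {1/2..}"
    then have x': "1/2 \<le> x" by simp
    have e: "- 1 / 2 - real 0 = - 1 / 2" "- 1 / 2 - real 1 = - 3 / 2" "- 1 / 2 - real 2 = - 5 / 2"
      "- 1 / 2 - real 3 = - 7 / 2" by simp_all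
    note b' = b[OF x', of 0, unfolded e] b[OF x', of 1, unfolded e]
      b[OF x', of 2, unfolded e] b[OF x', of 3, unfolded e]
    show "((\<lambda>x. x powr (-1/2)) has_real_derivative - 1 / 2 * x powr (- 3 / 2)) (at x within {1/2..})"
      using d[OF x', of 1 0] by simp
    show "((\<lambda>x. - 1 / 2 * x powr (- 3 / 2)) has_real_derivative 3 / 4 * x powr (- 5 / 2)) (at x within {1/2..})"
      using d[OF x', of "-1/2" 1] by simp
    show "((\<lambda>x. 3 / 4 * x powr (- 5 / 2)) has_real_derivative - 15 / 8 * x powr (- 7 / 2)) (at x within {1/2..})"
      using d[OF x', of "3/4" 2] by simp
    show "\<bar>x powr (-1/2)\<bar> \<le> 30" "\<bar>- 1 / 2 * x powr (- 3 / 2)\<bar> \<le> 30 * 1"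
      "\<bar>3 / 4 * x powr (- 5 / 2)\<bar> \<le> 30 * 1\<^sup>2" "\<bar>- 15 / 8 * x powr (- 7 / 2)\<bar> \<le> 30 * 1 ^ 3"
      using b' by (simp_all add: abs_mult)
  qed
qed

lemma cosqrt_1_0: "cosqrt 1 0 = - 1 / 2"
proof -
  have "cosqrt 1 0 = cosqrt_coeff 1 0"
    by (simp only: cosqrt_def powser_zero)
  then show ?thesis by (simp add: cosqrt_coeff_def)
qed

text \<open>
  This says that sin \<theta> \<ge> \<theta> cos \<theta>. It keeps the derivative of cos \<surd>x away from 0, so that this
  function can be inverted smoothly.
\<close>

lemma cosqrt_1_le:
  assumes "0 \<le> \<theta>" "\<theta> \<le> pi / 2"
  shows "cosqrt 1 (\<theta>\<^sup>2) \<le> - (cos \<theta> / 2)"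
proof (cases "\<theta> = 0")
  case True
  then show ?thesis using cosqrt_1_0 by simp
next
  case False
  then have "0 < \<theta>" using assms by simp
  from MVT2[OF this, of sin cos] obtain z where z: "0 < z" "z < \<theta>" "sin \<theta> = \<theta> * cos z"
    by (auto intro: DERIV_sin)
  have "cos \<theta> \<le> cos z"
    using z assms by (intro cos_monotone_0_pi_le) auto
  then have "\<theta> * cos \<theta> \<le> \<theta> * (- 2 * cosqrt 1 (\<theta>\<^sup>2))"
    using z \<open>0 < \<theta>\<close> sin_eq_cosqrt[of \<theta>] by (simp add: mult_ac)
  then have "cos \<theta> \<le> - 2 * cosqrt 1 (\<theta>\<^sup>2)"
    using \<open>0 < \<theta>\<close> by (simp only: mult_le_cancel_left_pos)
  then show ?thesis by simp
qed

text \<open>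
  The lower bound is sinh r \<ge> r.
\<close>

lemma cosqrt_1_neg_ge:
  assumes "-1 \<le> x" "x \<le> 0"
  shows "1/2 \<le> - cosqrt 1 x" "- cosqrt 1 x \<le> 3"
proof -
  show "- cosqrt 1 x \<le> 3"
  proof -
    have "exp \<bar>x\<bar> \<le> exp 1" using assms by simp
    then show ?thesis using abs_cosqrt_le_exp[of 1 x] exp_le by linarith
  qed
  show "1/2 \<le> - cosqrt 1 x"
  proof (cases "x = 0")
    case True
    then show ?thesis using cosqrt_1_0 by simp
  next
    case False
    define r where "r = sqrt (- x)"
    have r: "0 < r" "x = - r\<^sup>2" using False assms by (simp_all add: r_def)
    have "(sinh has_real_derivative cosh x) (at x)" for x :: real
      by (auto intro!: derivative_eq_intros)
    from MVT2[OF r(1) this] obtain z where "sinh r = r * cosh z"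
      by auto
    then have "r * cosh z = r * (- 2 * cosqrt 1 x)"
      using sinh_eq_cosqrt[of r] r by simp
    then have "cosh z = - 2 * cosqrt 1 x" using r(1) by (simp only: mult_cancel_left) auto
    then show ?thesis using cosh_real_ge_1[of z] by simp
  qed
qed

text \<open>
  The square of arccos is the inverse function of x \<mapsto> cos \<surd>x. Hence it is smooth up to the endpoint 1,
  where arccos itself is not, and its derivatives are rational expressions in those of cos \<surd>x.
\<close>

lemma smooth3_arccos_square: "smooth3 {3/4..1} 500 1 (\<lambda>z. (arccos z)\<^sup>2)"
proof -
  define A where "A = (\<lambda>z. (arccos z)\<^sup>2)"
  have A: "0 \<le> A z" "A z \<le> 4" "cosqrt 1 (A z) \<le> - (3/8)" if "z \<in> {3/4..1}" for z
  proof -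
    have th: "0 \<le> arccos z" "arccos z \<le> pi / 2" using that arccos_lbound[of z] arccos_le_pi2[of z] by auto
    then have "(arccos z)\<^sup>2 \<le> 2\<^sup>2" using pi_less_4 by (intro power_mono) auto
    then show "0 \<le> A z" "A z \<le> 4" by (auto simp: A_def)
    show "cosqrt 1 (A z) \<le> - (3/8)"
      using cosqrt_1_le[OF th] that by (simp add: A_def)
  qed
  have contA: "continuous_on {3/4..1} A"
    unfolding A_def by (intro continuous_intros) auto
  have dA: "(A has_real_derivative inverse (cosqrt 1 (A z))) (at z within {3/4..1})"
    if z: "z \<in> {3/4..1}" for z
  proof (rule has_real_derivative_Icc_from_interior[where g = "\<lambda>z. inverse (cosqrt 1 (A z))"])
    show "continuous_on {3/4..1} (\<lambda>z. inverse (cosqrt 1 (A z)))"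
      using A by (intro continuous_intros contA) force
    fix z :: real assume z: "3/4 < z" "z < 1"
    define \<theta> where "\<theta> = arccos z"
    have th: "0 < \<theta>" "\<theta> < pi" "cos \<theta> = z" using z by (auto simp: \<theta>_def arccos_lt_bounded)
    have "(A has_real_derivative 2 * \<theta> * inverse (- sqrt (1 - z\<^sup>2))) (at z)"
      unfolding A_def \<theta>_def using z by (auto intro!: derivative_eq_intros)
    moreover have "sqrt (1 - z\<^sup>2) = sin \<theta>"
      using z by (simp add: \<theta>_def sin_arccos)
    moreover have "2 * \<theta> * inverse (- sin \<theta>) = inverse (cosqrt 1 (A z))"
      using th sin_eq_cosqrt[of \<theta>] by (simp add: A_def flip: \<theta>_def)
    ultimately show "(A has_real_derivative inverse (cosqrt 1 (A z))) (at z)" by simp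
  qed (use contA z in auto)
  define A1 where "A1 z = inverse (cosqrt 1 (A z))" for z
  \<comment> \<open>From A' = 1/C'(A) the next derivatives are -C''/C'^3 and 3 C''^2/C'^5 - C^(3)/C'^4, taken at A.\<close>
  define A2 where "A2 z = - cosqrt 2 (A z) * A1 z ^ 3" for z
  define A3 where "A3 z = - cosqrt 3 (A z) * A1 z ^ 4 + 3 * (cosqrt 2 (A z))\<^sup>2 * A1 z ^ 5" for z
  have dA: "(A has_real_derivative A1 z) (at z within {3/4..1})" if "z \<in> {3/4..1}" for z
    using dA that by (simp add: A1_def)
  have dA1: "(A1 has_real_derivative A2 z) (at z within {3/4..1})" if z: "z \<in> {3/4..1}" for z
  proof -
    have "cosqrt 1 (A z) \<noteq> 0" using A[OF z] by linarith
    from DERIV_inverse'[OF DERIV_cosqrt_chain[OF dA[OF z]] this] show ?thesis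
      by (simp add: A1_def[abs_def] A2_def power3_eq_cube numeral_2_eq_2 mult_ac)
  qed
  have dA2: "(A2 has_real_derivative A3 z) (at z within {3/4..1})" if z: "z \<in> {3/4..1}" for z
  proof -
    have "(A2 has_real_derivative - (cosqrt (Suc 2) (A z) * A1 z) * A1 z ^ 3
         + (3 * A1 z ^ 2 * A2 z) * - cosqrt 2 (A z)) (at z within {3/4..1})"
      unfolding A2_def [abs_def]
      by (rule derivative_eq_intros refl dA dA1 z)+ (simp add: A2_def mult_ac)
    also have "- (cosqrt (Suc 2) (A z) * A1 z) * A1 z ^ 3 + (3 * A1 z ^ 2 * A2 z) * - cosqrt 2 (A z) = A3 z"
    proof -
      have e: "A1 z ^ 4 = A1 z * A1 z ^ 3" "A1 z ^ 5 = A1 z * A1 z * A1 z ^ 3" "Suc 2 = 3"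
        by (simp_all add: eval_nat_numeral mult.assoc)
      show ?thesis
        unfolding A3_def A2_def e power2_eq_square by (simp add: algebra_simps)
    qed
    finally show ?thesis .
  qed
  have bound: "\<bar>A z\<bar> \<le> 500 \<and> \<bar>A1 z\<bar> \<le> 500 \<and> \<bar>A2 z\<bar> \<le> 500 \<and> \<bar>A3 z\<bar> \<le> 500" if z: "z \<in> {3/4..1}" for z
  proof -
    have c: "\<bar>cosqrt k (A z)\<bar> \<le> 1" for k using A[OF z] abs_cosqrt_le_1 by blast
    have "\<bar>A1 z\<bar> = inverse \<bar>cosqrt 1 (A z)\<bar>" by (simp add: A1_def)
    also have "\<dots> \<le> inverse (3/8)" using A[OF z] by (intro le_imp_inverse_le) auto
    finally have a: "\<bar>A1 z\<bar> \<le> 8/3" by simp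
    have ak: "\<bar>A1 z ^ k\<bar> \<le> (8/3) ^ k" for k
      unfolding power_abs using a by (intro power_mono) auto
    have "\<bar>A2 z\<bar> \<le> 1 * (8/3) ^ 3"
      unfolding A2_def by (intro abs_mult_le ak) (simp add: c)
    moreover have "\<bar>- cosqrt 3 (A z) * A1 z ^ 4\<bar> \<le> 1 * (8/3) ^ 4"
      by (intro abs_mult_le ak) (simp add: c)
    moreover have "\<bar>3 * (cosqrt 2 (A z))\<^sup>2 * A1 z ^ 5\<bar> \<le> 3 * (8/3) ^ 5"
      by (intro abs_mult_le ak) (simp add: c abs_square_le_1)
    ultimately have "\<bar>A2 z\<bar> \<le> 1 * (8/3) ^ 3 \<and> \<bar>A3 z\<bar> \<le> 1 * (8/3) ^ 4 + 3 * (8/3) ^ 5"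
      unfolding A3_def by linarith
    moreover have "\<bar>A z\<bar> \<le> 4" using A[OF z] by simp
    moreover have "(8/3) ^ 3 \<le> (500::real)" "(8/3) ^ 4 + 3 * (8/3) ^ 5 \<le> (500::real)"
      by (simp_all add: field_simps)
    ultimately show ?thesis using a by linarith
  qed
  show ?thesis
    unfolding smooth3_def A_def[symmetric] using dA dA1 dA2 bound
    by (intro exI[of _ A1] exI[of _ A2] exI[of _ A3]) auto
qed

text \<open>
  With a = t^2 and v = t^2 - u^2 this is, for k = 0, the quotient (cosh t - cosh u)/v, and in general its
  k-th derivative in v. The integral form of the divided difference stays smooth at v = 0.
\<close>

definition kernel_int :: "nat \<Rightarrow> real \<Rightarrow> real \<Rightarrow> real" where
  "kernel_int k a v = - integral {0..1} (\<lambda>s. s ^ k * cosqrt (Suc k) (s * v - a))"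

lemma mult_kernel_int: "v * kernel_int 0 a v = cosqrt 0 (- a) - cosqrt 0 (v - a)"
proof -
  have "((\<lambda>s. cosqrt 1 (s * v - a) * v) has_integral cosqrt 0 (1 * v - a) - cosqrt 0 (0 * v - a)) {0..1}"
  proof (rule fundamental_theorem_of_calculus)
    fix s :: real
    have "((\<lambda>s. cosqrt 0 (s * v - a)) has_real_derivative cosqrt 1 (s * v - a) * v) (at s within {0..1})"
      by (rule derivative_eq_intros refl)+ simp
    then show "((\<lambda>s. cosqrt 0 (s * v - a)) has_vector_derivative cosqrt 1 (s * v - a) * v) (at s within {0..1})"
      by (simp add: has_real_derivative_iff_has_vector_derivative)
  qed simp
  from integral_unique[OF this]
  have "integral {0..1} (\<lambda>s. cosqrt 1 (s * v - a)) * v = cosqrt 0 (v - a) - cosqrt 0 (- a)"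
    by simp
  then show ?thesis
    by (simp add: kernel_int_def mult.commute)
qed

lemma segment_bounds:
  fixes a s v :: real
  assumes "0 < a" "a \<le> 1" "v \<in> {0..a}" "s \<in> {0..1}"
  shows "-1 \<le> s * v - a" "s * v - a \<le> 0"
proof -
  have "0 \<le> s * v" using assms by simp
  moreover have "s * v \<le> 1 * a" by (rule mult_mono) (use assms in auto)
  ultimately show "-1 \<le> s * v - a" "s * v - a \<le> 0" using assms(1,2) by linarith+
qed

lemma DERIV_kernel_int:
  assumes "v \<in> {0..a}"
  shows "(kernel_int k a has_real_derivative kernel_int (Suc k) a v) (at v within {0..a})"
proof -
  have "((\<lambda>v. integral (cbox 0 1) (\<lambda>s. s ^ k * cosqrt (Suc k) (s * v - a))) has_real_derivative
      integral (cbox 0 1) (\<lambda>s. s ^ Suc k * cosqrt (Suc (Suc k)) (s * v - a))) (at v within {0..a})"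
  proof (rule leibniz_rule_field_derivative)
    fix x t :: real
    show "((\<lambda>x. t ^ k * cosqrt (Suc k) (t * x - a)) has_real_derivative
        t ^ Suc k * cosqrt (Suc (Suc k)) (t * x - a)) (at x within {0..a})"
      by (rule derivative_eq_intros refl)+ simp
    show "(\<lambda>s. s ^ k * cosqrt (Suc k) (s * x - a)) integrable_on cbox 0 1"
      by (intro integrable_continuous continuous_intros)
    show "continuous_on ({0..a} \<times> cbox 0 1)
        (\<lambda>(x, t). t ^ Suc k * cosqrt (Suc (Suc k)) (t * x - a))"
      unfolding split_def by (intro continuous_intros)
  qed (use assms in auto)
  then show ?thesis
    unfolding kernel_int_def by (auto intro!: derivative_eq_intros)
qed

lemma abs_kernel_int_le:
  assumes "0 < a" "a \<le> 1" "v \<in> {0..a}"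
  shows "\<bar>kernel_int k a v\<bar> \<le> 3"
proof -
  have "norm (integral {0..1} (\<lambda>s. s ^ k * cosqrt (Suc k) (s * v - a))) \<le> 3 * (1 - 0)"
  proof (rule integral_bound)
    show "continuous_on {0..1} (\<lambda>s. s ^ k * cosqrt (Suc k) (s * v - a))"
      by (intro continuous_intros)
    fix s :: real assume s: "s \<in> {0..1}"
    note b = segment_bounds[OF assms s]
    then have "exp \<bar>s * v - a\<bar> \<le> exp 1" by simp
    then have "\<bar>cosqrt (Suc k) (s * v - a)\<bar> \<le> 3"
      using abs_cosqrt_le_exp[of "Suc k" "s * v - a"] exp_le by linarith
    moreover have "\<bar>s ^ k\<bar> \<le> 1" using s by (simp add: power_le_one)
    ultimately show "norm (s ^ k * cosqrt (Suc k) (s * v - a)) \<le> 3"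
      using abs_mult_le[of "s ^ k" 1 "cosqrt (Suc k) (s * v - a)" 3] by simp
  qed simp
  then show ?thesis by (simp add: kernel_int_def)
qed

lemma kernel_int_ge_half:
  assumes "0 < a" "a \<le> 1" "v \<in> {0..a}"
  shows "1/2 \<le> kernel_int 0 a v"
proof -
  have "integral {0..1} (\<lambda>s::real. 1/2 :: real) \<le> integral {0..1} (\<lambda>s. - cosqrt 1 (s * v - a))"
  proof (rule integral_le)
    show "(\<lambda>s. - cosqrt 1 (s * v - a)) integrable_on {0..1}"
      by (intro integrable_continuous_real continuous_intros)
  qed (use cosqrt_1_neg_ge(1) segment_bounds[OF assms] in auto)
  then show ?thesis by (simp add: kernel_int_def)
qed

lemma smooth3_kernel_int:
  assumes "0 < a" "a \<le> 1"
  shows "smooth3 {0..a} 3 1 (kernel_int 0 a)"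
  unfolding smooth3_def
  using DERIV_kernel_int[of _ a 0] DERIV_kernel_int[of _ a 1] DERIV_kernel_int[of _ a 2]
    abs_kernel_int_le[OF assms]
  by (intro exI[of _ "kernel_int 1 a"] exI[of _ "kernel_int 2 a"] exI[of _ "kernel_int 3 a"])
    (auto simp: numeral_2_eq_2 numeral_3_eq_3)

text \<open>
  With a = t^2 and v = t^2 - u^2 this is cosh (u/2) / cosh (t/2), the cosine of the argument \<psi> of w at
  the point where |w|^2 = exp u.
\<close>

definition cos_angle :: "real \<Rightarrow> real \<Rightarrow> real" where
  "cos_angle a v = cosqrt 0 ((v - a) / 4) / cosqrt 0 (- a / 4)"

text \<open>
  The lower bound 3/4 keeps \<psi> inside the range where the square of arccos has bounded derivatives.
\<close>

lemma cos_angle_bounds: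
  assumes "0 < a" "a \<le> 1" "v \<in> {0..a}"
  shows "cos_angle a v \<in> {3/4..1}" "1 \<le> cosqrt 0 (- a / 4)"
proof -
  have ge1: "1 \<le> cosqrt 0 (- x / 4)" if "x \<ge> 0" for x
    using cosqrt_neg_square[of "sqrt x / 2"] cosh_real_ge_1[of "sqrt x / 2"] that
    by (simp add: power_divide)
  show "1 \<le> cosqrt 0 (- a / 4)" using ge1[of a] assms by simp
  have "cosqrt 0 (- a / 4) \<le> exp (a / 4)"
    using abs_cosqrt_le_exp[of 0 "- a / 4"] assms by simp
  also have "\<dots> \<le> 1 + a / 4 + (a / 4)\<^sup>2"
    using assms by (intro exp_bound) auto
  also have "\<dots> \<le> 1 + 1 / 4 + (1 / 4)\<^sup>2"
    using assms by (intro add_mono power_mono) auto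
  also have "\<dots> \<le> 4 / 3" by (simp add: power2_eq_square)
  finally have up: "cosqrt 0 (- a / 4) \<le> 4 / 3" .
  have "1 \<le> cosqrt 0 ((v - a) / 4)"
    using ge1[of "a - v"] assms by simp
  moreover have "cosqrt 0 ((v - a) / 4) \<le> cosqrt 0 (- a / 4)"
  proof (rule DERIV_nonpos_imp_nonincreasing[where f = "cosqrt 0"])
    fix x assume x: "- a / 4 \<le> x" "x \<le> (v - a) / 4"
    have "cosqrt 1 x \<le> 0" using cosqrt_1_neg_ge[of x] x assms by auto
    then show "\<exists>y. (cosqrt 0 has_real_derivative y) (at x) \<and> y \<le> 0"
      using DERIV_cosqrt[of 0 x] by auto
  qed (use assms in auto)
  ultimately show "cos_angle a v \<in> {3/4..1}"
    using up ge1[of a] assms unfolding cos_angle_def by (auto simp: field_simps)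
qed

lemma smooth3_cos_angle:
  assumes "0 < a" "a \<le> 1"
  shows "smooth3 {0..a} 3 1 (cos_angle a)"
proof -
  define d where "d = cosqrt 0 (- a / 4)"
  have d: "1 \<le> d" using cos_angle_bounds(2)[OF assms, of 0] assms by (simp add: d_def)
  have deriv: "((\<lambda>v. cosqrt k ((v - a) / 4) / (4 ^ k * d)) has_real_derivative
      cosqrt (Suc k) ((v - a) / 4) / (4 ^ Suc k * d)) (at v within S)" for k v S
  proof -
    have "((\<lambda>v. cosqrt k ((v - a) / 4)) has_real_derivative cosqrt (Suc k) ((v - a) / 4) * (1 / 4))
        (at v within S)"
      by (rule DERIV_cosqrt_chain) (auto intro!: derivative_eq_intros)
    from DERIV_cdivide[OF this, of "4 ^ k * d"] show ?thesis by (simp add: mult.assoc)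
  qed
  have bound: "\<bar>cosqrt k ((v - a) / 4) / (4 ^ k * d)\<bar> \<le> 3" if "v \<in> {0..a}" for k v
  proof -
    have "exp \<bar>(v - a) / 4\<bar> \<le> exp 1" using that assms by (simp add: abs_if)
    then have c: "\<bar>cosqrt k ((v - a) / 4)\<bar> \<le> 3"
      using abs_cosqrt_le_exp[of k "(v - a) / 4"] exp_le by linarith
    have "1 * 1 \<le> 4 ^ k * d" using d by (intro mult_mono) auto
    then have "\<bar>cosqrt k ((v - a) / 4)\<bar> / (4 ^ k * d) \<le> 3 / 1"
      using c by (intro frac_le) auto
    then show ?thesis using d by (simp add: abs_mult)
  qed
  show ?thesis
    unfolding smooth3_def cos_angle_def[abs_def] d_def[symmetric]
    using deriv[of 0] deriv[of 1] deriv[of 2] bound[of _ 0] bound[of _ 1] bound[of _ 2] bound[of _ 3]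
    by (intro exI[of _ "\<lambda>v. cosqrt 1 ((v - a) / 4) / (4 ^ 1 * d)"]
        exI[of _ "\<lambda>v. cosqrt 2 ((v - a) / 4) / (4 ^ 2 * d)"]
        exI[of _ "\<lambda>v. cosqrt 3 ((v - a) / 4) / (4 ^ 3 * d)"])
      (simp add: numeral_2_eq_2 numeral_3_eq_3)
qed

text \<open>
  The amplitude F of the oscillatory integral for the spherical function, with a = t^2. The last factor is
  cos (2n \<psi>), the first one normalises the value at v = 0 to 1.
\<close>

definition profile :: "real \<Rightarrow> real \<Rightarrow> real \<Rightarrow> real" where
  "profile n a v = sqrt (- cosqrt 1 (- a)) * kernel_int 0 a v powr (-1/2) *
     cosqrt 0 (4 * n\<^sup>2 * (arccos (cos_angle a v))\<^sup>2)"

lemma profile_0: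
  assumes "0 < a" "a \<le> 1"
  shows "profile n a 0 = 1"
proof -
  have c: "1/2 \<le> - cosqrt 1 (- a)" using cosqrt_1_neg_ge[of "- a"] assms by simp
  have "kernel_int 0 a 0 = - cosqrt 1 (- a)" by (simp add: kernel_int_def)
  moreover have "cos_angle a 0 = 1"
    using cos_angle_bounds(2)[OF assms, of 0] assms by (simp add: cos_angle_def)
  moreover have "cosqrt 0 0 = 1" using cosqrt_square[of 0] by simp
  ultimately show ?thesis
    using c by (simp add: profile_def powr_minus powr_half_sqrt)
qed

lemma smooth3_profile:
  obtains M where "M \<ge> 1"
    "\<And>n a. 0 < a \<Longrightarrow> a \<le> 1 \<Longrightarrow> smooth3 {0..a} M (4 * (1 + \<bar>n\<bar>)\<^sup>2) (profile n a)"
proof -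
  \<comment> \<open>Every composition contributes 5 L^3 and every product 8; the innermost constants are the 500, 3, 30
    of the building blocks and 2 for the prefactor.\<close>
  define L where "L = 5 * (500 * 3 ^ 3 :: real)"
  define M where "M = 8 * (8 * (2 * (5 * (30 * 3 ^ 3))) * (5 * (1 * L ^ 3)))"
  have M: "M \<ge> 1" by (simp add: M_def L_def)
  have "smooth3 {0..a} M (4 * (1 + \<bar>n\<bar>)\<^sup>2) (profile n a)" if a: "0 < a" "a \<le> 1" for n a
  proof -
    define N where "N = 4 * (1 + \<bar>n\<bar>)\<^sup>2"
    have "n\<^sup>2 \<le> (1 + \<bar>n\<bar>)\<^sup>2"
      by (auto simp: abs_le_square_iff[symmetric])
    moreover have "1 \<le> (1 + \<bar>n\<bar>)\<^sup>2"
      by (rule one_le_power) simp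
    ultimately have N: "4 * n\<^sup>2 \<le> N" "1 \<le> N" unfolding N_def by linarith+
    have "smooth3 {0..a} L 1 (\<lambda>v. (arccos (cos_angle a v))\<^sup>2)"
      unfolding L_def
      by (rule smooth3_compose[OF smooth3_arccos_square smooth3_cos_angle[OF a]])
        (use cos_angle_bounds(1)[OF a] in auto)
    then have 1: "smooth3 {0..a} (5 * (1 * L ^ 3)) N (\<lambda>v. cosqrt 0 (4 * n\<^sup>2 * (arccos (cos_angle a v))\<^sup>2))"
      by (intro smooth3_compose[OF smooth3_cosqrt_scaled[OF _ N(1)]]) (use N in \<open>auto simp: L_def\<close>)
    have r: "smooth3 {1/2..} 30 N (\<lambda>x. x powr (-1/2))"
      using smooth3_rsqrt N(2) by (rule smooth3_mono_scale) auto
    have 2: "smooth3 {0..a} (5 * (30 * 3 ^ 3)) N (\<lambda>v. kernel_int 0 a v powr (-1/2))"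
      by (rule smooth3_compose[OF r smooth3_kernel_int[OF a]])
        (use kernel_int_ge_half[OF a] N in auto)
    define c where "c = sqrt (- cosqrt 1 (- a))"
    have "sqrt (- cosqrt 1 (- a)) \<le> sqrt 4"
      using cosqrt_1_neg_ge[of "- a"] a by (intro real_sqrt_le_mono) auto
    then have c: "\<bar>c\<bar> \<le> 2" using cosqrt_1_neg_ge[of "- a"] a by (simp add: c_def)
    have 0: "smooth3 {0..a} 2 N (\<lambda>v. c)"
      unfolding smooth3_def using c N
      by (intro exI[of _ "\<lambda>_. 0"]) auto
    have "smooth3 {0..a} M N (\<lambda>v. c * kernel_int 0 a v powr (-1/2) *
        cosqrt 0 (4 * n\<^sup>2 * (arccos (cos_angle a v))\<^sup>2))"
      unfolding M_def
      by (intro smooth3_mult 0 1 2) (use N in \<open>auto simp: L_def\<close>)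
    then show ?thesis
      by (simp only: profile_def[abs_def] c_def N_def)
  qed
  with M that show ?thesis by blast
qed

section \<open>Oscillatory integrals of amplitudes vanishing to third order\<close>

text \<open>
  The step of the Taylor estimate: from a bound for the derivative to one for the function, by the mean
  value theorem. It keeps the same constant B at every order.
\<close>

lemma abs_le_mult_power_Suc:
  fixes h h' :: "real \<Rightarrow> real"
  assumes deriv: "\<And>x. x \<in> {0..a} \<Longrightarrow> (h has_real_derivative h' x) (at x within {0..a})"
    and bound: "\<And>x. x \<in> {0..a} \<Longrightarrow> \<bar>h' x\<bar> \<le> B * x ^ k"
    and "h 0 = 0" "B \<ge> 0" and v: "v \<in> {0..a}"
  shows "\<bar>h v\<bar> \<le> B * v ^ Suc k"
proof -
  have "norm (h v - h 0) \<le> (B * v ^ k) * norm (v - 0)"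
  proof (rule field_differentiable_bound[where S = "{0..v}" and f' = h'])
    fix z assume z: "z \<in> {0..v}"
    show "(h has_real_derivative h' z) (at z within {0..v})"
      by (rule has_field_derivative_subset[OF deriv]) (use z v in auto)
    have "\<bar>h' z\<bar> \<le> B * z ^ k" using bound[of z] z v by auto
    also have "\<dots> \<le> B * v ^ k" using z assms(4) by (intro mult_left_mono power_mono) auto
    finally show "norm (h' z) \<le> B * v ^ k" by simp
  qed (use v in auto)
  then show ?thesis using v assms(3) by (simp add: mult_ac)
qed

text \<open>
  In the variable u = t sin \<phi> the integral is that of cos (l u) f(u), where f(u) = H(v)/r with
  r = (t^2-u^2)^(1/2) = t cos \<phi> and v = r^2. Since H vanishes to third order, f, f' and f'' are O(B r) and
  f^(3) is O(B/r), so three integrations by parts produce no boundary terms and gain the factor l^(-3).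
  Working in \<phi> with the operator (1/r) d/d\<phi> = d/du makes all integrands bounded, as the Jacobian r cancels
  the singularity of f^(3).
\<close>

lemma oscillatory_integral_bound:
  fixes H H1 H2 H3 :: "real \<Rightarrow> real"
  assumes t: "0 < t" "t \<le> 1" and l: "0 < l"
    and deriv: "\<And>v. v \<in> {0..t\<^sup>2} \<Longrightarrow> (H has_real_derivative H1 v) (at v within {0..t\<^sup>2})"
    "\<And>v. v \<in> {0..t\<^sup>2} \<Longrightarrow> (H1 has_real_derivative H2 v) (at v within {0..t\<^sup>2})"
    "\<And>v. v \<in> {0..t\<^sup>2} \<Longrightarrow> (H2 has_real_derivative H3 v) (at v within {0..t\<^sup>2})"
    and bound: "\<And>v. v \<in> {0..t\<^sup>2} \<Longrightarrow> \<bar>H v\<bar> \<le> B * v ^ 3"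
    "\<And>v. v \<in> {0..t\<^sup>2} \<Longrightarrow> \<bar>H1 v\<bar> \<le> B * v ^ 2"
    "\<And>v. v \<in> {0..t\<^sup>2} \<Longrightarrow> \<bar>H2 v\<bar> \<le> B * v ^ 1"
    "\<And>v. v \<in> {0..t\<^sup>2} \<Longrightarrow> \<bar>H3 v\<bar> \<le> B * v ^ 0"
    and B: "B \<ge> 0"
  shows "\<bar>integral {-pi/2..pi/2} (\<lambda>\<phi>. cos (l * (t * sin \<phi>)) * H ((t * cos \<phi>)\<^sup>2))\<bar>
    \<le> 90 * pi * B / l ^ 3"
proof -
  define r where "r \<phi> = t * cos \<phi>" for \<phi>
  define u where "u \<phi> = t * sin \<phi>" for \<phi>
  \<comment> \<open>All derivatives of f are combinations of the terms K(v)/r^m. At the endpoints r = 0, where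
    division by zero gives the correct limit value 0 for the terms that occur in G.\<close>
  define T where "T K m \<phi> = K ((r \<phi>)\<^sup>2) / r \<phi> ^ m" for K :: "real \<Rightarrow> real" and m \<phi>
  \<comment> \<open>P0, ..., P3 are the derivatives of H(v) v^(-1/2) in v, and f1, f2, f3 those of f in u, where dv/du = -2u.\<close>
  define P0 where "P0 = T H 1"
  define P1 where "P1 \<phi> = T H1 1 \<phi> - 1/2 * T H 3 \<phi>" for \<phi>
  define P2 where "P2 \<phi> = T H2 1 \<phi> - T H1 3 \<phi> + 3/4 * T H 5 \<phi>" for \<phi>
  define P3 where "P3 \<phi> = T H3 1 \<phi> - 3/2 * T H2 3 \<phi> + 9/4 * T H1 5 \<phi> - 15/8 * T H 7 \<phi>" for \<phi>
  define f1 where "f1 \<phi> = - 2 * u \<phi> * P1 \<phi>" for \<phi>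
  define f2 where "f2 \<phi> = 4 * (u \<phi>)\<^sup>2 * P2 \<phi> - 2 * P1 \<phi>" for \<phi>
  define f3 where "f3 \<phi> = 12 * u \<phi> * P2 \<phi> - 8 * u \<phi> ^ 3 * P3 \<phi>" for \<phi>
  \<comment> \<open>Three integrations by parts at once: the derivative of G is the given integrand minus
    sin (l u) r f3 / l^3.\<close>
  define G where "G \<phi> = sin (l * u \<phi>) * P0 \<phi> / l + cos (l * u \<phi>) * f1 \<phi> / l ^ 2
      - sin (l * u \<phi>) * f2 \<phi> / l ^ 3" for \<phi>
  define I where "I = {-pi/2<..<pi/2}"
  define J where "J = {-pi/2..pi/2}"
  have r01: "0 \<le> r \<phi>" "r \<phi> \<le> 1" "(r \<phi>)\<^sup>2 \<in> {0..t\<^sup>2}" if "\<phi> \<in> J" for \<phi>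
  proof -
    have c: "0 \<le> cos \<phi>" using that by (intro cos_ge_zero) (auto simp: J_def)
    then show "0 \<le> r \<phi>" using t by (simp add: r_def)
    have "t * cos \<phi> \<le> 1 * 1" using c t by (intro mult_mono) auto
    then show "r \<phi> \<le> 1" by (simp add: r_def)
    have "(cos \<phi>)\<^sup>2 \<le> 1\<^sup>2" using c by (intro power_mono) auto
    then show "(r \<phi>)\<^sup>2 \<in> {0..t\<^sup>2}" using t by (simp add: r_def power_mult_distrib mult_left_le)
  qed
  have rpos: "0 < r \<phi>" if "\<phi> \<in> I" for \<phi>
    using that t cos_gt_zero_pi[of \<phi>] by (simp add: r_def I_def)
  have u1: "\<bar>u \<phi>\<bar> \<le> 1" for \<phi>
    using abs_mult_le[of t 1 "sin \<phi>" 1] t by (simp add: u_def)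
  have dr: "(r has_real_derivative - u \<phi>) (at \<phi> within S)" for \<phi> S
    unfolding r_def[abs_def] u_def by (rule derivative_eq_intros refl)+ simp
  have du: "(u has_real_derivative r \<phi>) (at \<phi> within S)" for \<phi> S
    unfolding r_def u_def[abs_def] by (rule derivative_eq_intros refl)+ simp
  have dT: "(T K m has_real_derivative - 2 * r \<phi> * u \<phi> * (T K' m \<phi> - m / 2 * T K (m + 2) \<phi>)) (at \<phi>)"
    if K: "\<And>v. v \<in> {0..t\<^sup>2} \<Longrightarrow> (K has_real_derivative K' v) (at v within {0..t\<^sup>2})"
      and \<phi>: "\<phi> \<in> I" for K K' m \<phi>
  proof -
    have IJ: "I \<subseteq> J" by (auto simp: I_def J_def)
    have "(K has_real_derivative K' ((r \<phi>)\<^sup>2)) (at ((r \<phi>)\<^sup>2) within (\<lambda>\<phi>. (r \<phi>)\<^sup>2) ` I)"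
      by (rule has_field_derivative_subset[OF K]) (use r01(3) \<phi> IJ in auto)
    moreover have "((\<lambda>\<phi>. (r \<phi>)\<^sup>2) has_real_derivative - 2 * r \<phi> * u \<phi>) (at \<phi> within I)"
      by (rule derivative_eq_intros refl dr)+ simp
    ultimately have "((\<lambda>\<phi>. K ((r \<phi>)\<^sup>2)) has_real_derivative K' ((r \<phi>)\<^sup>2) * (- 2 * r \<phi> * u \<phi>)) (at \<phi> within I)"
      using DERIV_image_chain[of K "K' ((r \<phi>)\<^sup>2)" "\<lambda>\<phi>. (r \<phi>)\<^sup>2" \<phi> I "- 2 * r \<phi> * u \<phi>"]
      by (simp only: o_def)
    then have dK: "((\<lambda>\<phi>. K ((r \<phi>)\<^sup>2)) has_real_derivative K' ((r \<phi>)\<^sup>2) * (- 2 * r \<phi> * u \<phi>)) (at \<phi>)"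
      using \<phi> at_within_open[of \<phi> I] by (simp add: I_def)
    have nz: "r \<phi> \<noteq> 0" "r \<phi> ^ m \<noteq> 0" using rpos[OF \<phi>] by auto
    have dm: "((\<lambda>\<phi>. r \<phi> ^ m) has_real_derivative m * r \<phi> ^ (m - 1) * (- u \<phi>)) (at \<phi>)"
      by (rule derivative_eq_intros refl dr)+ simp
    have e: "real m * r \<phi> ^ (m - 1) = real m * r \<phi> ^ m / r \<phi>"
      using nz by (cases m) auto
    have "(K' ((r \<phi>)\<^sup>2) * (- 2 * r \<phi> * u \<phi>) * r \<phi> ^ m - K ((r \<phi>)\<^sup>2) * (m * r \<phi> ^ (m - 1) * (- u \<phi>)))
        / (r \<phi> ^ m * r \<phi> ^ m)
      = - 2 * r \<phi> * u \<phi> * (K' ((r \<phi>)\<^sup>2) / r \<phi> ^ m - m / 2 * (K ((r \<phi>)\<^sup>2) / r \<phi> ^ (m + 2)))"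
      unfolding e power_add using nz by (simp add: field_simps power2_eq_square)
    then show ?thesis
      unfolding T_def by (rule DERIV_cong[OF DERIV_divide[OF dK dm nz(2)]])
  qed
  have dP0: "(P0 has_real_derivative r \<phi> * f1 \<phi>) (at \<phi>)" if "\<phi> \<in> I" for \<phi>
    unfolding P0_def
    by (rule DERIV_cong[OF dT[OF deriv(1) that]]) (simp_all add: f1_def P1_def numeral_eq_Suc)
  have dP1: "(P1 has_real_derivative - 2 * r \<phi> * u \<phi> * P2 \<phi>) (at \<phi>)" if "\<phi> \<in> I" for \<phi>
    unfolding P1_def[abs_def]
    by (rule DERIV_cong[OF DERIV_diff[OF dT[OF deriv(2) that] DERIV_cmult[OF dT[OF deriv(1) that]]]])
      (simp_all add: P2_def algebra_simps numeral_eq_Suc)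
  have dP2: "(P2 has_real_derivative - 2 * r \<phi> * u \<phi> * P3 \<phi>) (at \<phi>)" if "\<phi> \<in> I" for \<phi>
    unfolding P2_def[abs_def]
    by (rule DERIV_cong[OF DERIV_add[OF DERIV_diff[OF dT[OF deriv(3) that] dT[OF deriv(2) that]]
            DERIV_cmult[OF dT[OF deriv(1) that]]]])
      (simp_all add: P3_def algebra_simps numeral_eq_Suc)
  have df1: "(f1 has_real_derivative r \<phi> * f2 \<phi>) (at \<phi>)" if "\<phi> \<in> I" for \<phi>
    unfolding f1_def[abs_def]
    by (rule derivative_eq_intros refl du dP1 that)+ (simp add: f2_def algebra_simps power2_eq_square)
  have df2: "(f2 has_real_derivative r \<phi> * f3 \<phi>) (at \<phi>)" if "\<phi> \<in> I" for \<phi>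
    unfolding f2_def[abs_def]
    by (rule derivative_eq_intros refl du dP1 dP2 that)+
      (simp add: f3_def algebra_simps power2_eq_square power3_eq_cube)
  have dG: "(G has_real_derivative cos (l * u \<phi>) * H ((r \<phi>)\<^sup>2) - sin (l * u \<phi>) * (r \<phi> * f3 \<phi>) / l ^ 3) (at \<phi>)"
    if \<phi>: "\<phi> \<in> I" for \<phi>
  proof -
    have ds: "((\<lambda>\<phi>. sin (l * u \<phi>)) has_real_derivative cos (l * u \<phi>) * (l * r \<phi>)) (at \<phi>)"
      by (rule derivative_eq_intros refl du)+ simp
    have dc: "((\<lambda>\<phi>. cos (l * u \<phi>)) has_real_derivative - sin (l * u \<phi>) * (l * r \<phi>)) (at \<phi>)"
      by (rule derivative_eq_intros refl du)+ simp
    have "H ((r \<phi>)\<^sup>2) = r \<phi> * P0 \<phi>"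
      using rpos[OF \<phi>] by (simp add: P0_def T_def)
    then show ?thesis
      unfolding G_def[abs_def]
      by (intro DERIV_cong[OF DERIV_diff[OF DERIV_add[OF
            DERIV_cdivide[OF DERIV_mult[OF ds dP0[OF \<phi>]]] DERIV_cdivide[OF DERIV_mult[OF dc df1[OF \<phi>]]]]
            DERIV_cdivide[OF DERIV_mult[OF ds df2[OF \<phi>]]]]])
        (use l in \<open>simp add: field_simps power2_eq_square power3_eq_cube\<close>)
  qed
  \<comment> \<open>Counting powers of r: a k-th order zero of K in v counts 2k.\<close>
  have Tb: "\<bar>T K m \<phi>\<bar> * r \<phi> ^ j \<le> B * r \<phi> ^ i"
    if K: "\<And>v. v \<in> {0..t\<^sup>2} \<Longrightarrow> \<bar>K v\<bar> \<le> B * v ^ k" and \<phi>: "\<phi> \<in> J" and ij: "2 * k + j = i + m" "0 < m" for K k m \<phi> i j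
  proof (cases "r \<phi> = 0")
    case True
    then show ?thesis using ij(2) B by (simp add: T_def zero_power)
  next
    case False
    then have pos: "0 < r \<phi>" using r01[OF \<phi>] by simp
    have "\<bar>K ((r \<phi>)\<^sup>2)\<bar> * r \<phi> ^ j \<le> (B * ((r \<phi>)\<^sup>2) ^ k) * r \<phi> ^ j"
      using K[OF r01(3)[OF \<phi>]] pos by (intro mult_right_mono) auto
    also have "\<dots> = B * r \<phi> ^ i * r \<phi> ^ m"
      using ij by (simp only: mult.assoc flip: power_mult power_add)
    finally show ?thesis
      using pos by (simp add: T_def abs_mult field_simps)
  qed
  have TbJ: "\<bar>T K m \<phi>\<bar> \<le> B * r \<phi>"
    if K: "\<And>v. v \<in> {0..t\<^sup>2} \<Longrightarrow> \<bar>K v\<bar> \<le> B * v ^ k" and "\<phi> \<in> J" "0 < m" "m < 2 * k" for K k m \<phi>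
  proof -
    have "\<bar>T K m \<phi>\<bar> * r \<phi> ^ 0 \<le> B * r \<phi> ^ (2 * k - m)"
      by (rule Tb[OF K]) (use that in auto)
    also have "\<dots> \<le> B * r \<phi> ^ 1"
      using B r01[OF \<open>\<phi> \<in> J\<close>] that by (intro mult_left_mono power_decreasing) auto
    finally show ?thesis by simp
  qed
  have P0b: "\<bar>P0 \<phi>\<bar> \<le> B * r \<phi>" if "\<phi> \<in> J" for \<phi>
    unfolding P0_def by (rule TbJ[OF bound(1) that]) auto
  have P1b: "\<bar>P1 \<phi>\<bar> \<le> 3/2 * (B * r \<phi>)" if "\<phi> \<in> J" for \<phi>
  proof -
    have "\<bar>T H1 1 \<phi>\<bar> \<le> B * r \<phi>" "\<bar>T H 3 \<phi>\<bar> \<le> B * r \<phi>"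
      by (rule TbJ[OF bound(2) that] TbJ[OF bound(1) that]; simp)+
    then show ?thesis unfolding P1_def by linarith
  qed
  have P2b: "\<bar>P2 \<phi>\<bar> \<le> 11/4 * (B * r \<phi>)" if "\<phi> \<in> J" for \<phi>
  proof -
    have "\<bar>T H2 1 \<phi>\<bar> \<le> B * r \<phi>" "\<bar>T H1 3 \<phi>\<bar> \<le> B * r \<phi>" "\<bar>T H 5 \<phi>\<bar> \<le> B * r \<phi>"
      by (rule TbJ[OF bound(3) that] TbJ[OF bound(2) that] TbJ[OF bound(1) that]; simp)+
    then show ?thesis unfolding P2_def by linarith
  qed
  have P3b: "\<bar>r \<phi> * P3 \<phi>\<bar> \<le> 53/8 * B" if "\<phi> \<in> J" for \<phi>
  proof -
    have "\<bar>T H3 1 \<phi>\<bar> * r \<phi> ^ 1 \<le> B * r \<phi> ^ 0" "\<bar>T H2 3 \<phi>\<bar> * r \<phi> ^ 1 \<le> B * r \<phi> ^ 0"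
      "\<bar>T H1 5 \<phi>\<bar> * r \<phi> ^ 1 \<le> B * r \<phi> ^ 0" "\<bar>T H 7 \<phi>\<bar> * r \<phi> ^ 1 \<le> B * r \<phi> ^ 0"
      by (rule Tb[OF bound(4) that] Tb[OF bound(3) that] Tb[OF bound(2) that] Tb[OF bound(1) that]; simp)+
    then have "\<bar>r \<phi> * T H3 1 \<phi>\<bar> \<le> B" "\<bar>r \<phi> * T H2 3 \<phi>\<bar> \<le> B" "\<bar>r \<phi> * T H1 5 \<phi>\<bar> \<le> B" "\<bar>r \<phi> * T H 7 \<phi>\<bar> \<le> B"
      using r01(1)[OF that] by (simp_all add: abs_mult mult.commute)
    moreover have "r \<phi> * P3 \<phi> = r \<phi> * T H3 1 \<phi> - 3/2 * (r \<phi> * T H2 3 \<phi>) + 9/4 * (r \<phi> * T H1 5 \<phi>) - 15/8 * (r \<phi> * T H 7 \<phi>)"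
      unfolding P3_def by (simp add: algebra_simps)
    ultimately show ?thesis by linarith
  qed
  have uk: "\<bar>u \<phi> ^ k\<bar> \<le> 1" for \<phi> k
    unfolding power_abs using u1[of \<phi>] by (intro power_le_one) auto
  have f1b: "\<bar>f1 \<phi>\<bar> \<le> 3 * (B * r \<phi>)" if "\<phi> \<in> J" for \<phi>
    using abs_mult_le[OF u1[of \<phi>] P1b[OF that]] unfolding f1_def mult.assoc by linarith
  have f2b: "\<bar>f2 \<phi>\<bar> \<le> 14 * (B * r \<phi>)" if "\<phi> \<in> J" for \<phi>
    using abs_mult_le[OF uk[of \<phi> 2] P2b[OF that]] P1b[OF that] unfolding f2_def mult.assoc by linarith
  \<comment> \<open>86 = 12 * 11/4 + 8 * 53/8.\<close>
  have f3b: "\<bar>r \<phi> * f3 \<phi>\<bar> \<le> 86 * B" if "\<phi> \<in> J" for \<phi>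
  proof -
    have rr: "\<bar>r \<phi>\<bar> \<le> 1" using r01[OF that] by simp
    have "B * r \<phi> \<le> B * 1" using r01[OF that] B by (intro mult_left_mono) auto
    then have "\<bar>P2 \<phi>\<bar> \<le> 11/4 * B" using P2b[OF that] by linarith
    from abs_mult_le[OF abs_mult_le[OF rr u1[of \<phi>]] this] have "\<bar>r \<phi> * u \<phi> * P2 \<phi>\<bar> \<le> 11/4 * B" by simp
    moreover have "\<bar>u \<phi> ^ 3 * (r \<phi> * P3 \<phi>)\<bar> \<le> 53/8 * B"
      using abs_mult_le[OF uk P3b[OF that]] by simp
    moreover have "r \<phi> * f3 \<phi> = 12 * (r \<phi> * u \<phi> * P2 \<phi>) - 8 * (u \<phi> ^ 3 * (r \<phi> * P3 \<phi>))"
      unfolding f3_def by (simp add: algebra_simps)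
    ultimately show ?thesis by linarith
  qed
  define c where "c = B / l + 3 * B / l ^ 2 + 14 * B / l ^ 3"
  have Gb: "\<bar>G \<phi>\<bar> \<le> c * r \<phi>" if "\<phi> \<in> J" for \<phi>
  proof -
    have "\<bar>sin (l * u \<phi>) * P0 \<phi> / l\<bar> \<le> B * r \<phi> / l"
      using abs_mult_le[OF abs_sin_le_one P0b[OF that], of "l * u \<phi>"] l by (simp add: divide_right_mono)
    moreover have "\<bar>cos (l * u \<phi>) * f1 \<phi> / l ^ 2\<bar> \<le> 3 * (B * r \<phi>) / l ^ 2"
      using abs_mult_le[OF abs_cos_le_one f1b[OF that], of "l * u \<phi>"] l by (simp add: divide_right_mono)
    moreover have "\<bar>sin (l * u \<phi>) * f2 \<phi> / l ^ 3\<bar> \<le> 14 * (B * r \<phi>) / l ^ 3"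
      using abs_mult_le[OF abs_sin_le_one f2b[OF that], of "l * u \<phi>"] l by (simp add: divide_right_mono)
    moreover have "c * r \<phi> = B * r \<phi> / l + 3 * (B * r \<phi>) / l ^ 2 + 14 * (B * r \<phi>) / l ^ 3"
      unfolding c_def by (simp add: algebra_simps add_divide_distrib)
    ultimately show ?thesis unfolding G_def by linarith
  qed
  have ends: "r (pi/2) = 0" "r (-pi/2) = 0" "pi/2 \<in> J" "-pi/2 \<in> J"
    using pi_gt_zero by (simp_all add: r_def J_def)
  have G0: "G (pi/2) = 0" "G (-pi/2) = 0"
    using Gb[of "pi/2"] Gb[of "-pi/2"] ends by simp_all
  have contG: "continuous_on J G"
    unfolding continuous_on_eq_continuous_within
  proof
    fix \<phi> assume \<phi>: "\<phi> \<in> J"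
    show "continuous (at \<phi> within J) G"
    proof (cases "\<phi> \<in> I")
      case True
      from DERIV_isCont[OF dG[OF True]] show ?thesis
        by (rule continuous_at_imp_continuous_within)
    next
      case False
      then have "\<phi> = pi/2 \<or> \<phi> = -pi/2" using \<phi> by (auto simp: I_def J_def)
      then have z: "r \<phi> = 0" "G \<phi> = 0" using ends G0 by metis+
      have "continuous (at \<phi> within J) r" by (rule DERIV_continuous[OF dr])
      then have "(r \<longlongrightarrow> 0) (at \<phi> within J)" using z by (simp add: continuous_within)
      then have "((\<lambda>\<phi>. c * r \<phi>) \<longlongrightarrow> 0) (at \<phi> within J)" by (rule tendsto_mult_right_zero)
      then have "(G \<longlongrightarrow> 0) (at \<phi> within J)"
        by (rule Lim_null_comparison[rotated]) (auto simp: eventually_at_filter Gb)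
      then show ?thesis using z by (simp add: continuous_within)
    qed
  qed
  have contH: "continuous_on J (\<lambda>\<phi>. cos (l * u \<phi>) * H ((r \<phi>)\<^sup>2))"
  proof -
    have cH: "continuous_on {0..t\<^sup>2} H" by (rule DERIV_continuous_on[OF deriv(1)])
    have "continuous_on J (\<lambda>\<phi>. H ((r \<phi>)\<^sup>2))"
      by (rule continuous_on_compose2[OF cH]) (use r01 in \<open>auto simp: r_def intro!: continuous_intros\<close>)
    then show ?thesis unfolding u_def by (intro continuous_intros)
  qed
  have "((\<lambda>\<phi>. cos (l * u \<phi>) * H ((r \<phi>)\<^sup>2) - sin (l * u \<phi>) * (r \<phi> * f3 \<phi>) / l ^ 3)
      has_integral G (pi/2) - G (-pi/2)) J"
    unfolding J_def
    by (rule fundamental_theorem_of_calculus_interior)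
      (use contG dG in \<open>auto simp: J_def I_def has_real_derivative_iff_has_vector_derivative\<close>)
  then have 1: "((\<lambda>\<phi>. cos (l * u \<phi>) * H ((r \<phi>)\<^sup>2) - sin (l * u \<phi>) * (r \<phi> * f3 \<phi>) / l ^ 3) has_integral 0) J"
    by (simp only: G0 diff_self)
  define V where "V = integral J (\<lambda>\<phi>. cos (l * u \<phi>) * H ((r \<phi>)\<^sup>2))"
  have 2: "((\<lambda>\<phi>. cos (l * u \<phi>) * H ((r \<phi>)\<^sup>2)) has_integral V) J"
    unfolding V_def J_def
    by (rule integrable_integral[OF integrable_continuous_real[OF contH[unfolded J_def]]])
  have "((\<lambda>\<phi>. sin (l * u \<phi>) * (r \<phi> * f3 \<phi>) / l ^ 3) has_integral V) J"
    using has_integral_diff[OF 2 1] by simp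
  then have "norm V \<le> (86 * B / l ^ 3) * measure lborel J"
    unfolding J_def cbox_interval[symmetric]
  proof (rule has_integral_bound[rotated])
    show "0 \<le> 86 * B / l ^ 3" using B l by simp
    fix \<phi> :: real assume "\<phi> \<in> cbox (- pi / 2) (pi / 2)"
    then have "\<phi> \<in> J" by (simp add: J_def)
    then have "\<bar>sin (l * u \<phi>) * (r \<phi> * f3 \<phi>)\<bar> \<le> 1 * (86 * B)"
      by (intro abs_mult_le f3b) auto
    then show "norm (sin (l * u \<phi>) * (r \<phi> * f3 \<phi>) / l ^ 3) \<le> 86 * B / l ^ 3"
      using l by (simp add: divide_right_mono)
  qed
  also have "measure lborel J = pi" unfolding J_def using pi_gt_zero by simp
  also have "86 * B / l ^ 3 * pi \<le> 90 * pi * B / l ^ 3"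
    using B l pi_gt_zero by (simp add: divide_right_mono mult_right_mono)
  finally show ?thesis
    by (simp add: V_def J_def u_def r_def)
qed

section \<open>Poisson's integral for the Bessel functions\<close>

text \<open>
  The Beta integral B(k+1/2, j+1/2) in trigonometric form.
\<close>

definition wallis :: "nat \<Rightarrow> nat \<Rightarrow> real" where
  "wallis k j = integral {-pi/2..pi/2} (\<lambda>\<phi>. sin \<phi> ^ (2 * k) * cos \<phi> ^ (2 * j))"

text \<open>
  The first identity integrates the derivative of sin^(2k+1) cos^(2j+1), the second is sin^2 + cos^2 = 1.
\<close>

lemma wallis_rec:
  "(2 * real k + 1) * wallis k (Suc j) = (2 * real j + 1) * wallis (Suc k) j"
  "wallis k (Suc j) + wallis (Suc k) j = wallis k j"
proof -
  have int: "((\<lambda>\<phi>. sin \<phi> ^ (2 * k) * cos \<phi> ^ (2 * j)) has_integral wallis k j) {-pi/2..pi/2}" for k j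
    unfolding wallis_def
    by (intro integrable_integral integrable_continuous_real continuous_intros)
  have i1: "((\<lambda>\<phi>. (2 * real k + 1) * (sin \<phi> ^ (2 * k) * cos \<phi> ^ (2 * Suc j))
      - (2 * real j + 1) * (sin \<phi> ^ (2 * Suc k) * cos \<phi> ^ (2 * j)))
      has_integral (sin (pi/2) ^ (2 * k + 1) * cos (pi/2) ^ (2 * j + 1)
        - sin (-pi/2) ^ (2 * k + 1) * cos (-pi/2) ^ (2 * j + 1))) {-pi/2..pi/2}"
  proof (rule fundamental_theorem_of_calculus)
    fix \<phi> :: real
    have "((\<lambda>\<phi>. sin \<phi> ^ (2 * k + 1) * cos \<phi> ^ (2 * j + 1)) has_real_derivative
      (2 * real k + 1) * (sin \<phi> ^ (2 * k) * cos \<phi> ^ (2 * Suc j))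
      - (2 * real j + 1) * (sin \<phi> ^ (2 * Suc k) * cos \<phi> ^ (2 * j))) (at \<phi> within {-pi/2..pi/2})"
      by (rule derivative_eq_intros refl)+ (simp add: algebra_simps)
    then show "((\<lambda>\<phi>. sin \<phi> ^ (2 * k + 1) * cos \<phi> ^ (2 * j + 1)) has_vector_derivative
      (2 * real k + 1) * (sin \<phi> ^ (2 * k) * cos \<phi> ^ (2 * Suc j))
      - (2 * real j + 1) * (sin \<phi> ^ (2 * Suc k) * cos \<phi> ^ (2 * j))) (at \<phi> within {-pi/2..pi/2})"
      by (simp only: has_real_derivative_iff_has_vector_derivative)
  qed simp
  have i2: "((\<lambda>\<phi>. (2 * real k + 1) * (sin \<phi> ^ (2 * k) * cos \<phi> ^ (2 * Suc j))
      - (2 * real j + 1) * (sin \<phi> ^ (2 * Suc k) * cos \<phi> ^ (2 * j)))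
      has_integral ((2 * real k + 1) * wallis k (Suc j) - (2 * real j + 1) * wallis (Suc k) j)) {-pi/2..pi/2}"
    by (intro has_integral_diff has_integral_mult_right int)
  have "cos (-pi/2) = 0" using cos_minus[of "pi/2"] by simp
  with has_integral_unique[OF i1 i2]
  show "(2 * real k + 1) * wallis k (Suc j) = (2 * real j + 1) * wallis (Suc k) j"
    by (simp del: of_nat_Suc)
  have "((\<lambda>\<phi>. sin \<phi> ^ (2 * k) * cos \<phi> ^ (2 * Suc j) + sin \<phi> ^ (2 * Suc k) * cos \<phi> ^ (2 * j))
     has_integral (wallis k (Suc j) + wallis (Suc k) j)) {-pi/2..pi/2}"
    by (intro has_integral_add int)
  moreover have "sin \<phi> ^ (2 * k) * cos \<phi> ^ (2 * Suc j) + sin \<phi> ^ (2 * Suc k) * cos \<phi> ^ (2 * j)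
      = sin \<phi> ^ (2 * k) * cos \<phi> ^ (2 * j)" for \<phi> :: real
  proof -
    have "sin \<phi> ^ (2 * k) * cos \<phi> ^ (2 * Suc j) + sin \<phi> ^ (2 * Suc k) * cos \<phi> ^ (2 * j)
      = sin \<phi> ^ (2 * k) * cos \<phi> ^ (2 * j) * ((sin \<phi>)\<^sup>2 + (cos \<phi>)\<^sup>2)"
      unfolding mult_Suc_right power_add distrib_left by (simp only: mult_ac add_ac)
    then show ?thesis by simp
  qed
  ultimately have "((\<lambda>\<phi>. sin \<phi> ^ (2 * k) * cos \<phi> ^ (2 * j))
     has_integral (wallis k (Suc j) + wallis (Suc k) j)) {-pi/2..pi/2}"
    by simp
  then show "wallis k (Suc j) + wallis (Suc k) j = wallis k j"
    using int has_integral_unique by blast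
qed

lemma Gamma_Suc_half: "Gamma (real (Suc m) + 1/2) = (real m + 1/2) * Gamma (real m + 1/2)"
proof -
  have "real m + 1/2 \<notin> \<int>\<^sub>\<le>\<^sub>0" by (auto elim!: nonpos_Ints_cases)
  from Gamma_plus1[OF this] show ?thesis by (simp add: add_ac)
qed

lemma wallis_eq_Gamma:
  "wallis k j = Gamma (real k + 1/2) * Gamma (real j + 1/2) / fact (k + j)"
proof -
  have step: "2 * (real k + real j + 1) * wallis (Suc k) j = (2 * real k + 1) * wallis k j"
    "2 * (real k + real j + 1) * wallis k (Suc j) = (2 * real j + 1) * wallis k j" for k j
    using wallis_rec[of k j] by algebra+
  show ?thesis
  proof (induction k)
    case 0
    show ?case
    proof (induction j)
      case 0
      show ?case by (simp add: wallis_def Gamma_one_half_real)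
    next
      case (Suc j)
      have "wallis 0 (Suc j) = (2 * real j + 1) * wallis 0 j / (2 * (real j + 1))"
        using step(2)[of 0 j] by (simp add: field_simps)
      then show ?case using Suc unfolding Gamma_Suc_half by (simp add: field_simps)
    qed
  next
    case (Suc k)
    have "wallis (Suc k) j = (2 * real k + 1) * wallis k j / (2 * (real k + real j + 1))"
      using step(1)[of k j] by (simp add: field_simps)
    then show ?case using Suc unfolding Gamma_Suc_half by (simp add: field_simps)
  qed
qed

lemma Gamma_half_nat: "Gamma (real k + 1/2) * (4 ^ k * fact k) = sqrt pi * fact (2 * k)"
proof (induction k)
  case 0
  show ?case by (simp add: Gamma_one_half_real)
next
  case (Suc k)
  have "Gamma (real (Suc k) + 1/2) * (4 ^ Suc k * fact (Suc k))
      = (2 * (real k + 1) * (2 * real k + 1)) * (Gamma (real k + 1/2) * (4 ^ k * fact k))"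
    unfolding Gamma_Suc_half by (simp add: field_simps)
  also have "\<dots> = sqrt pi * fact (2 * Suc k)"
    unfolding Suc by (simp add: algebra_simps)
  finally show ?case .
qed

text \<open>
  Expand the cosine in its power series, integrate term by term with the Beta integral, and compare with the
  Bessel series by means of the duplication formula for the Gamma function at half-integers.
\<close>

lemma poisson_integral:
  assumes z: "z > 0"
  shows "integral {-pi/2..pi/2} (\<lambda>\<phi>. cos (z * sin \<phi>) * cos \<phi> ^ (2 * j)) = 2 * sqrt pi * cal_J_punctured (real j) z"
proof -
  define J where "J = {-pi/2..pi/2::real}"
  define F where "F N \<phi> = (\<Sum>k<N. cos_coeff (2 * k) * (z * sin \<phi>) ^ (2 * k)) * cos \<phi> ^ (2 * j)" for N and \<phi> :: real
  define G where "G \<phi> = cos (z * sin \<phi>) * cos \<phi> ^ (2 * j)" for \<phi> :: real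
  have co: "cos_coeff (2 * k) = (-1) ^ k / fact (2 * k)" for k
    by (simp add: cos_coeff_def)
  have "uniform_limit J (\<lambda>N \<phi>. \<Sum>k<N. cos_coeff (2 * k) * (z * sin \<phi>) ^ (2 * k))
      (\<lambda>\<phi>. \<Sum>k. cos_coeff (2 * k) * (z * sin \<phi>) ^ (2 * k)) sequentially"
  proof (rule Weierstrass_m_test)
    show "summable (\<lambda>k. z ^ (2 * k) / fact (2 * k))"
    proof -
      have "summable (\<lambda>m. inverse (fact m) * z ^ m)" by (rule summable_exp)
      then have "summable ((\<lambda>m. inverse (fact m) * z ^ m) \<circ> (\<lambda>k. 2 * k))"
        by (rule summable_reindex) (use z in \<open>auto simp: inj_on_def\<close>)
      then show ?thesis by (simp add: o_def field_simps)
    qed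
    fix k and \<phi> :: real
    have "\<bar>sin \<phi>\<bar> ^ (2 * k) \<le> 1" by (intro power_le_one) auto
    then have "z ^ (2 * k) * \<bar>sin \<phi>\<bar> ^ (2 * k) \<le> z ^ (2 * k)" using z by (simp add: mult_left_le)
    then show "norm (cos_coeff (2 * k) * (z * sin \<phi>) ^ (2 * k)) \<le> z ^ (2 * k) / fact (2 * k)"
      using z by (simp add: co abs_mult power_abs power_mult_distrib divide_right_mono)
  qed
  moreover have "(\<Sum>k. cos_coeff (2 * k) * x ^ (2 * k)) = cos x" for x :: real
    using cos_paired[of x] by (simp add: co sums_iff)
  ultimately have "uniform_limit J (\<lambda>N \<phi>. \<Sum>k<N. cos_coeff (2 * k) * (z * sin \<phi>) ^ (2 * k))
      (\<lambda>\<phi>. cos (z * sin \<phi>)) sequentially" by simp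
  then have ul: "uniform_limit J F G sequentially"
    unfolding F_def G_def
    by (rule uniform_lim_mult)
      (auto intro!: uniform_limit_const simp: bounded_iff power_abs power_le_one intro!: exI[of _ 1])
  have cF: "continuous_on {-pi/2..pi/2} (F N)" for N
    unfolding F_def by (intro continuous_intros)
  obtain I V where "\<And>N. (F N has_integral I N) {-pi/2..pi/2}" "(G has_integral V) {-pi/2..pi/2}"
    and V2: "I \<longlonglongrightarrow> V"
    by (rule uniform_limit_integral[OF ul[unfolded J_def] cF]) auto
  then have I: "(F N has_integral I N) J" and V: "(G has_integral V) J" for N
    by (simp_all add: J_def)
  define a where "a k = cos_coeff (2 * k) * z ^ (2 * k) * wallis k j" for k
  have "I N = (\<Sum>k<N. a k)" for N
  proof -
    have "((\<lambda>\<phi>. \<Sum>k<N. cos_coeff (2 * k) * z ^ (2 * k) * (sin \<phi> ^ (2 * k) * cos \<phi> ^ (2 * j))) has_integral (\<Sum>k<N. a k)) J"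
      unfolding a_def J_def wallis_def
      by (intro has_integral_sum has_integral_mult_right integrable_integral integrable_continuous_real continuous_intros) auto
    moreover have "(\<Sum>k<N. cos_coeff (2 * k) * z ^ (2 * k) * (sin \<phi> ^ (2 * k) * cos \<phi> ^ (2 * j))) = F N \<phi>" for \<phi>
      unfolding F_def sum_distrib_right by (rule sum.cong) (simp_all add: power_mult_distrib)
    ultimately have "(F N has_integral (\<Sum>k<N. a k)) J" by simp
    from has_integral_unique[OF I this] show ?thesis .
  qed
  then have "I = (\<lambda>N. \<Sum>k<N. a k)" by (rule ext)
  then have sums: "a sums V" using V2 unfolding sums_def by (simp only:)
  define c where "c = z powr real j * sqrt pi * Gamma (real j + 1/2) * 2 powr real j"
  have gpos: "0 < Gamma (real j + 1/2)"
    by (rule Gamma_real_pos) (simp add: add_nonneg_pos)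
  then have gnz: "Gamma (real j + 1/2) \<noteq> 0" by linarith
  then have cpos: "c \<noteq> 0" using z by (simp add: c_def)
  have term_eq: "(-1) ^ k / (fact k * Gamma (real j + real k + 1)) * (z / 2) powr (2 * real k + real j)
     = a k * (z powr real j / (sqrt pi * Gamma (real j + 1/2) * 2 powr real j))" for k
  proof -
    have g1: "Gamma (real j + real k + 1) = fact (k + j)"
      using Gamma_fact[of "k + j", where 'a = real] by (simp add: add_ac)
    have g2: "Gamma (real k + 1/2) = sqrt pi * fact (2 * k) / (4 ^ k * fact k)"
      using Gamma_half_nat[of k] by (simp add: field_simps)
    have g3: "Gamma (real j + 1/2) \<noteq> 0" by (rule gnz)
    have p: "(z / 2) powr (2 * real k + real j) = z ^ (2 * k) / 4 ^ k * (z powr real j / 2 powr real j)"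
    proof -
      have "(z / 2) powr (2 * real k + real j) = (z / 2) powr real (2 * k) * (z / 2) powr real j"
        using z by (simp add: powr_add)
      also have "(z / 2) powr real (2 * k) = (z / 2) ^ (2 * k)"
        using z by (subst powr_realpow) auto
      also have "\<dots> = z ^ (2 * k) / 4 ^ k"
        by (simp add: power_divide power_mult)
      also have "(z / 2) powr real j = z powr real j / 2 powr real j"
        using z by (simp add: powr_divide)
      finally show ?thesis .
    qed
    show ?thesis
      unfolding p a_def wallis_eq_Gamma g1 g2 co using g3 by (simp add: divide_simps)
  qed
  have "bessel_J (real j) z = V * (z powr real j / (sqrt pi * Gamma (real j + 1/2) * 2 powr real j))"
    unfolding bessel_J_def term_eq by (rule sums_unique[symmetric, OF sums_mult2[OF sums]])
  then have "cal_J_punctured (real j) z = V / (2 * sqrt pi)"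
    using z cpos unfolding cal_J_punctured_def c_def
    by (simp add: powr_diff field_simps)
  then show ?thesis
    using V by (simp add: integral_unique J_def flip: G_def)
qed

text \<open>
  Poisson's integral is continuous in z, also at z = 0.
\<close>

lemma cal_J_0_0: "cal_J 0 0 = sqrt pi / 2"
proof -
  define f where "f z = integral {-pi/2..pi/2} (\<lambda>\<phi>. cos (z * sin \<phi>)) / (2 * sqrt pi)" for z
  have "continuous_on UNIV (\<lambda>z. integral (cbox (-pi/2) (pi/2)) (\<lambda>\<phi>. cos (z * sin \<phi>)))"
    by (rule integral_continuous_on_param) (auto simp: split_def intro!: continuous_intros)
  then have "continuous_on UNIV f"
    unfolding f_def by (intro continuous_intros) auto
  then have "(f \<longlongrightarrow> f 0) (at 0)" by (simp add: continuous_on_def)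
  moreover have "f 0 = sqrt pi / 2"
    by (simp add: f_def field_simps real_div_sqrt)
  moreover have "cal_J_punctured 0 z = f z" if "z \<noteq> 0" for z
  proof -
    have "integral {-pi/2..pi/2} (\<lambda>\<phi>. cos (\<bar>z\<bar> * sin \<phi>)) = 2 * sqrt pi * cal_J_punctured 0 \<bar>z\<bar>"
      using poisson_integral[of "\<bar>z\<bar>" 0] that by simp
    moreover have "cos (\<bar>z\<bar> * x) = cos (z * x)" for x by (simp add: abs_if)
    ultimately show ?thesis by (simp add: f_def cal_J_punctured_def)
  qed
  ultimately have "(cal_J_punctured 0 \<longlongrightarrow> sqrt pi / 2) (at 0)"
    by (metis (no_types, lifting) Lim_cong_within)
  then have "Lim (at 0) (cal_J_punctured 0) = sqrt pi / 2"
    by (intro tendsto_Lim) auto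
  then show ?thesis by (simp add: cal_J_def)
qed

section \<open>The spherical function as an integral over the circle\<close>

text \<open>
  This is |w|^2 for the number w below.
\<close>

definition rho :: "real \<Rightarrow> real \<Rightarrow> real" where
  "rho t \<theta> = cosh t - sinh t * cos \<theta>"

text \<open>
  If (c, d) is the lower row of u(\<theta>) a(t), then d - i c = exp (i \<theta>/2) w.
\<close>

definition w_fun :: "real \<Rightarrow> real \<Rightarrow> complex" where
  "w_fun t \<theta> = of_real (cosh (t/2)) - of_real (sinh (t/2)) * cis (- \<theta>)"

lemma Re_w_fun: "Re (w_fun t \<theta>) = cosh (t/2) - sinh (t/2) * cos \<theta>"
  and Im_w_fun: "Im (w_fun t \<theta>) = sinh (t/2) * sin \<theta>"
  by (simp_all add: w_fun_def)

lemma Re_w_fun_pos: "0 < Re (w_fun t \<theta>)"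
proof -
  have "sinh (t/2) * cos \<theta> \<le> \<bar>sinh (t/2)\<bar> * 1"
    by (rule order_trans[OF abs_ge_self]) (simp add: abs_mult mult_left_le)
  also have "\<dots> < cosh (t/2)"
    using sinh_less_cosh_real[of "t/2"] sinh_less_cosh_real[of "- t/2"] by (simp add: abs_if)
  finally show ?thesis by (simp add: Re_w_fun)
qed

lemma norm_w_fun: "(norm (w_fun t \<theta>))\<^sup>2 = rho t \<theta>"
proof -
  have c: "cosh t = (cosh (t/2))\<^sup>2 + (sinh (t/2))\<^sup>2" "sinh t = 2 * sinh (t/2) * cosh (t/2)"
    using cosh_double[of "t/2"] sinh_double[of "t/2"] by simp_all
  have s: "(sin \<theta>)\<^sup>2 = 1 - (cos \<theta>)\<^sup>2" by (rule sin_squared_eq)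
  have "(norm (w_fun t \<theta>))\<^sup>2 = (cosh (t/2) - sinh (t/2) * cos \<theta>)\<^sup>2 + (sinh (t/2))\<^sup>2 * (sin \<theta>)\<^sup>2"
    by (simp add: cmod_power2 Re_w_fun Im_w_fun power_mult_distrib)
  also have "\<dots> = rho t \<theta>"
    unfolding rho_def c s by (simp add: algebra_simps power2_eq_square)
  finally show ?thesis .
qed

lemma rho_pos: "0 < rho t \<theta>"
  using Re_w_fun_pos[of t \<theta>] unfolding norm_w_fun[symmetric] by (auto simp: zero_less_power2)

lemma w_fun_nonpos: "w_fun t \<theta> \<notin> \<real>\<^sub>\<le>\<^sub>0" and w_fun_nz: "w_fun t \<theta> \<noteq> 0"
  using Re_w_fun_pos[of t \<theta>] by (auto simp: complex_nonpos_Reals_iff)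

definition phase :: "real \<Rightarrow> real \<Rightarrow> real" where
  "phase t \<theta> = Im (Ln (w_fun t \<theta>))"

lemma w_fun_polar: "w_fun t \<theta> = of_real (norm (w_fun t \<theta>)) * cis (phase t \<theta>)"
proof -
  have "w_fun t \<theta> = exp (Ln (w_fun t \<theta>))" using w_fun_nz by simp
  also have "\<dots> = of_real (exp (Re (Ln (w_fun t \<theta>)))) * cis (phase t \<theta>)"
    by (simp add: exp_eq_polar phase_def)
  finally show ?thesis using w_fun_nz[of t \<theta>] by simp
qed

text \<open>
  For Iwasawa coordinates t', \<theta>' of u(\<theta>) a(t), comparison of the lower rows gives
  exp (-t'/2) exp (i \<theta>'/2) = exp (i \<theta>/2) w. So exp (-t') = |w|^2, and (\<theta>' - \<theta>)/2 agrees with the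
  argument of w modulo 2\<pi>, which is enough because 2n is an integer.
\<close>

lemma spherical_integrand:
  assumes n: "2 * n \<in> \<int>"
  shows "alpha s (u_mat \<theta> ** a_mat t) * chi n (u_mat \<theta> ** a_mat t) * exp (- \<i> * of_real (n * \<theta>))
    = exp (- s * of_real (ln (rho t \<theta>))) * cis (2 * n * phase t \<theta>)"
proof -
  define g where "g = u_mat \<theta> ** a_mat t"
  have "det (u_mat \<theta>) = 1" "det (a_mat t) = 1"
    by (simp_all add: det_2 u_mat_def a_mat_def mult_exp_exp power2_eq_square[symmetric])
  then have "g \<in> SL2R"
    by (simp add: SL2R_def g_def det_mul)
  from theI'[OF iwasawa_unique[OF this]]
  obtain \<xi> t' \<theta>' where iw: "iwasawa g = (\<xi>, t', \<theta>')" "g = n_mat \<xi> ** a_mat t' ** u_mat \<theta>'"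
    unfolding iwasawa_def[symmetric] by (cases "iwasawa g") auto
  have g: "g = vector [vector [cos (\<theta>/2) * exp (t/2), sin (\<theta>/2) * exp (-t/2)],
      vector [- sin (\<theta>/2) * exp (t/2), cos (\<theta>/2) * exp (-t/2)]]"
    by (simp add: g_def vec_eq_iff forall_2 matrix_matrix_mult_def sum_2 a_mat_def u_mat_def)
  from iw(2)[unfolded nau_mat g vector2_eq_iff]
  have e: "exp (-t'/2) * sin (\<theta>'/2) = sin (\<theta>/2) * exp (t/2)" "exp (-t'/2) * cos (\<theta>'/2) = cos (\<theta>/2) * exp (-t/2)"
    by auto
  have "of_real (exp (-t'/2)) * cis (\<theta>'/2) = Complex (cos (\<theta>/2) * exp (-t/2)) (sin (\<theta>/2) * exp (t/2))"
    using e by (simp add: complex_eq_iff)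
  also have "\<dots> = cis (\<theta>/2) * w_fun t \<theta>"
  proof -
    have "cis (\<theta>/2) * w_fun t \<theta> = of_real (cosh (t/2)) * cis (\<theta>/2) - of_real (sinh (t/2)) * (cis (\<theta>/2) * cis (- \<theta>))"
      by (simp add: w_fun_def algebra_simps)
    also have "cis (\<theta>/2) * cis (- \<theta>) = cis (- (\<theta>/2))"
      by (simp add: cis_mult)
    finally have e1: "cis (\<theta>/2) * w_fun t \<theta> = of_real (cosh (t/2)) * cis (\<theta>/2) - of_real (sinh (t/2)) * cis (- (\<theta>/2))" .
    have e2: "exp (-t/2) = cosh (t/2) - sinh (t/2)" "exp (t/2) = cosh (t/2) + sinh (t/2)"
      by (simp_all add: cosh_minus_sinh cosh_plus_sinh)
    show ?thesis unfolding e1 e2 by (simp add: complex_eq_iff algebra_simps)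
  qed
  finally have main: "of_real (exp (-t'/2)) * cis (\<theta>'/2) = cis (\<theta>/2) * w_fun t \<theta>" .
  from arg_cong[OF this, of norm] have nw: "exp (-t'/2) = norm (w_fun t \<theta>)"
    by (simp add: norm_mult)
  then have "rho t \<theta> = exp (-t'/2) ^ 2" using norm_w_fun by simp
  also have "\<dots> = exp (-t')" by (simp flip: exp_of_nat_mult)
  finally have t': "t' = - ln (rho t \<theta>)" by simp
  have "of_real (norm (w_fun t \<theta>)) * cis (\<theta>'/2) = of_real (norm (w_fun t \<theta>)) * (cis (\<theta>/2) * cis (phase t \<theta>))"
    using main w_fun_polar[of t \<theta>] unfolding nw by (metis mult.left_commute)
  then have "cis (\<theta>'/2) = cis (\<theta>/2) * cis (phase t \<theta>)"
    using w_fun_nz[of t \<theta>] by simp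
  then have "cis (\<theta>'/2) * cis (- \<theta>/2) = cis (phase t \<theta>) * (cis (\<theta>/2) * cis (- \<theta>/2))"
    by simp
  then have c: "cis ((\<theta>' - \<theta>)/2) = cis (phase t \<theta>)"
    unfolding cis_mult by (simp add: diff_divide_distrib)
  obtain m :: int where m: "2 * n = of_int m" using n by (auto elim: Ints_cases)
  have "exp (\<i> * of_real (n * \<theta>')) * exp (- \<i> * of_real (n * \<theta>)) = cis (n * \<theta>') * cis (- (n * \<theta>))"
    by (simp add: cis_conv_exp)
  also have "\<dots> = cis (n * \<theta>' - n * \<theta>)" by (simp add: cis_mult)
  also have "n * \<theta>' - n * \<theta> = of_int m * ((\<theta>' - \<theta>)/2)"
    unfolding m[symmetric] by (simp add: algebra_simps)
  also have "cis (of_int m * ((\<theta>' - \<theta>)/2)) = cis ((\<theta>' - \<theta>)/2) powi m" by (simp add: cis_power_int)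
  also have "\<dots> = cis (2 * n * phase t \<theta>)" unfolding c m by (simp add: cis_power_int)
  finally have "exp (\<i> * of_real (n * \<theta>')) * exp (- \<i> * of_real (n * \<theta>)) = cis (2 * n * phase t \<theta>)" .
  then show ?thesis
    unfolding g_def[symmetric] alpha_def chi_def iw(1) by (simp add: t' mult.assoc)
qed

text \<open>
  The argument of w lies in (-\<pi>/2, \<pi>/2), so up to sign it is the arccos of its cosine; the sign is
  lost in cos.
\<close>

lemma cos_phase: "cos (c * phase t \<theta>) = cos (c * arccos (Re (w_fun t \<theta>) / sqrt (rho t \<theta>)))"
proof -
  have nr: "norm (w_fun t \<theta>) = sqrt (rho t \<theta>)"
    using norm_w_fun[of t \<theta>] by (metis norm_ge_zero real_sqrt_unique)
  have "\<bar>phase t \<theta>\<bar> < pi/2"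
    unfolding phase_def using Re_Ln_pos_lt[OF w_fun_nz] Re_w_fun_pos by blast
  then have "arccos (cos \<bar>phase t \<theta>\<bar>) = \<bar>phase t \<theta>\<bar>" by (intro arccos_cos) auto
  moreover have "cos (phase t \<theta>) = Re (w_fun t \<theta>) / sqrt (rho t \<theta>)"
    using arg_cong[OF w_fun_polar[of t \<theta>], of Re] rho_pos[of t \<theta>] by (simp add: nr)
  ultimately have "arccos (Re (w_fun t \<theta>) / sqrt (rho t \<theta>)) = \<bar>phase t \<theta>\<bar>" by simp
  then show ?thesis by (simp add: abs_if)
qed

lemma phase_reflect: "phase t (2 * pi - \<theta>) = - phase t \<theta>"
proof -
  have "w_fun t (2 * pi - \<theta>) = cnj (w_fun t \<theta>)"
    by (simp add: complex_eq_iff Re_w_fun Im_w_fun)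
  then show ?thesis
    by (simp add: phase_def cnj_Ln[OF w_fun_nonpos, symmetric])
qed

lemma phase_periodic: "phase t (\<theta> + 2 * pi) = phase t \<theta>"
proof -
  have "w_fun t (\<theta> + 2 * pi) = w_fun t \<theta>"
    by (simp add: complex_eq_iff Re_w_fun Im_w_fun)
  then show ?thesis by (simp add: phase_def)
qed

text \<open>
  The integrand has period 2\<pi>, and \<theta> \<mapsto> 2\<pi> - \<theta> conjugates w, so that the factors exp (\<plusminus>2in\<psi>)
  combine to a cosine on [0,\<pi>].
\<close>

lemma zeta_sph_a_mat:
  assumes n: "2 * n \<in> \<int>"
  shows "zeta_sph n s (a_mat t) = 1 / of_real pi * integral {0..pi} (\<lambda>\<theta>.
    exp (- s * of_real (ln (rho t \<theta>))) * of_real (cos (2 * n * phase t \<theta>)))"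
proof -
  define g where "g \<theta> = exp (- s * of_real (ln (rho t \<theta>))) * cis (2 * n * phase t \<theta>)" for \<theta>
  define h where "h \<theta> = exp (- s * of_real (ln (rho t \<theta>))) *
      of_real (cos (2 * n * phase t \<theta>))" for \<theta>
  have cont: "continuous_on S g" for S
    unfolding g_def phase_def rho_def w_fun_def
    by (intro continuous_intros) (use rho_pos w_fun_nonpos in \<open>auto simp: rho_def w_fun_def\<close>, metis less_irrefl)
  have int: "g integrable_on {a..b}" for a b
    by (rule integrable_continuous_real[OF cont])
  have per: "g (\<theta> + 2 * pi) = g \<theta>" for \<theta>
    by (simp add: g_def phase_periodic rho_def)
  have refl: "g \<theta> + g (2 * pi - \<theta>) = 2 * h \<theta>" for \<theta>
  proof -
    have "rho t (2 * pi - \<theta>) = rho t \<theta>" by (simp add: rho_def)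
    then have "g \<theta> + g (2 * pi - \<theta>) = exp (- s * of_real (ln (rho t \<theta>))) *
        (cis (2 * n * phase t \<theta>) + cis (- (2 * n * phase t \<theta>)))"
      by (simp add: g_def phase_reflect distrib_left)
    also have "cis x + cis (- x) = 2 * of_real (cos x)" for x by (simp add: complex_eq_iff)
    finally show ?thesis by (simp add: h_def)
  qed
  have "integral {0..4 * pi} g = integral {0..2 * pi} g + integral {2 * pi..4 * pi} g"
    by (rule Henstock_Kurzweil_Integration.integral_combine[symmetric]) (auto intro: int)
  also have "integral {2 * pi..4 * pi} g = integral {0..2 * pi} (\<lambda>\<theta>. g (\<theta> + 2 * pi))"
    using integral_shift_real_ivl[of "2 * pi" "2 * pi" "4 * pi" g] by simp
  also have "\<dots> = integral {0..2 * pi} g" by (simp add: per)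
  finally have i1: "integral {0..4 * pi} g = 2 * integral {0..2 * pi} g" by simp
  have "integral {0..2 * pi} g = integral {0..pi} g + integral {pi..2 * pi} g"
    by (rule Henstock_Kurzweil_Integration.integral_combine[symmetric]) (auto intro: int)
  also have "integral {pi..2 * pi} g = integral {-(2 * pi).. -pi} (\<lambda>x. g (- x))"
    using integral_reflect_real[where a = pi and b = "2 * pi" and f = g] by simp
  also have "\<dots> = integral {0..pi} (\<lambda>x. g (2 * pi - x))"
    using integral_shift_real_ivl[of "-(2 * pi)" "-(2 * pi)" "- pi" "\<lambda>x. g (- x)"] by simp
  also have "integral {0..pi} g + \<dots> = integral {0..pi} (\<lambda>x. g x + g (2 * pi - x))"
  proof (rule integral_add[symmetric])
    show "(\<lambda>x. g (2 * pi - x)) integrable_on {0..pi}"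
      by (intro integrable_continuous_real continuous_on_compose2[OF cont]) (auto intro!: continuous_intros)
  qed (rule int)
  also have "\<dots> = 2 * integral {0..pi} h" by (simp add: refl)
  finally have i2: "integral {0..2 * pi} g = 2 * integral {0..pi} h" .
  have "zeta_sph n s (a_mat t) = 1 / (4 * of_real pi) * integral {0..4 * pi} g"
    unfolding zeta_sph_def g_def using spherical_integrand[OF n] by simp
  then show ?thesis
    unfolding i1 i2 by (simp add: h_def[abs_def])
qed

section \<open>The spherical function as an oscillatory integral\<close>

text \<open>
  The substitution is cosh t - sinh t cos \<theta> = exp u with u = t sin \<phi>. It is strictly monotone from
  [-\<pi>/2,\<pi>/2] onto [0,\<pi>], and d\<theta>/d\<phi> = exp (u/2) (2(cosh t - cosh u)/v)^(-1/2) extends continuously to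
  the endpoints, where arccos fails to be differentiable. The factor exp (u/2) cancels against the modulus
  of |w|^(-2s) for s = 1/2 + i l. What remains besides exp (-i l u) is even in \<phi>, which leaves the cosine.
\<close>

lemma zeta_sph_eq_profile_integral:
  assumes n: "2 * n \<in> \<int>" and t: "0 < t" "t \<le> 1"
  shows "zeta_sph n (1/2 + \<i> * of_real l) (a_mat t) = of_real (sqrt (t / sinh t) / pi *
    integral {-pi/2..pi/2} (\<lambda>\<phi>. cos (l * (t * sin \<phi>)) * profile n (t\<^sup>2) ((t * cos \<phi>)\<^sup>2)))"
proof -
  define s where "s = 1/2 + \<i> * complex_of_real l"
  define u where "u \<phi> = t * sin \<phi>" for \<phi>
  define v where "v \<phi> = (t * cos \<phi>)\<^sup>2" for \<phi>
  define X where "X \<phi> = (cosh t - exp (u \<phi>)) / sinh t" for \<phi>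
  define g where "g \<phi> = arccos (X \<phi>)" for \<phi>
  define K where "K \<phi> = kernel_int 0 (t\<^sup>2) (v \<phi>)" for \<phi>
  define g' where "g' \<phi> = exp (u \<phi> / 2) / sqrt (2 * K \<phi>)" for \<phi>
  define f where "f \<theta> = exp (- s * of_real (ln (rho t \<theta>))) * of_real (cos (2 * n * phase t \<theta>))" for \<theta>
  define p where "p \<phi> = profile n (t\<^sup>2) (v \<phi>)" for \<phi>
  have sh: "0 < sinh t" and ch: "0 < cosh (t/2)" using t by simp_all
  have a: "0 < t\<^sup>2" "t\<^sup>2 \<le> 1" using t by (simp_all add: power_le_one)
  have v: "v \<phi> \<in> {0..t\<^sup>2}" for \<phi>
    using abs_square_le_1[of "cos \<phi>"] by (simp add: v_def power_mult_distrib mult_left_le)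
  have uv: "v \<phi> - t\<^sup>2 = - (u \<phi>)\<^sup>2" for \<phi>
    by (simp add: u_def v_def power_mult_distrib cos_squared_eq algebra_simps)
  have K: "1/2 \<le> K \<phi>" for \<phi>
    unfolding K_def by (rule kernel_int_ge_half[OF a v])
  have vK: "v \<phi> * K \<phi> = cosh t - cosh (u \<phi>)" for \<phi>
    unfolding K_def mult_kernel_int uv cosqrt_neg_square by simp
  have abs_u: "\<bar>u \<phi>\<bar> \<le> t" for \<phi>
    using t abs_sin_le_one[of \<phi>] by (simp add: u_def abs_mult mult_left_le)
  have X_ge: "-1 \<le> X \<phi>" and X_le: "X \<phi> \<le> 1" for \<phi>
  proof -
    have "exp (u \<phi>) \<le> exp t" "exp (- t) \<le> exp (u \<phi>)" using abs_u[of \<phi>] by simp_all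
    then have "- sinh t \<le> cosh t - exp (u \<phi>)" "cosh t - exp (u \<phi>) \<le> sinh t"
      using cosh_plus_sinh[of t] cosh_minus_sinh[of t] by linarith+
    then show "-1 \<le> X \<phi>" "X \<phi> \<le> 1" using sh by (simp_all add: X_def field_simps)
  qed
  have cosg: "cos (g \<phi>) = X \<phi>" for \<phi>
    using X_ge X_le by (simp add: g_def)
  have rho_g: "rho t (g \<phi>) = exp (u \<phi>)" for \<phi>
    using sh by (simp add: rho_def cosg X_def)
  have ends: "X (-pi/2) = 1" "X (pi/2) = -1"
    using sh cosh_plus_sinh[of t] cosh_minus_sinh[of t] by (simp_all add: X_def u_def field_simps)
  have g_ends: "g (-pi/2) = 0" "g (pi/2) = pi"
    unfolding g_def ends by simp_all
  have contX: "continuous_on S X" for S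
    unfolding X_def u_def by (intro continuous_intros) (use sh in auto)
  have contg: "continuous_on S g" for S
    unfolding g_def by (intro continuous_intros contX) (use X_ge X_le in auto)
  have contf: "continuous_on S f" for S
    unfolding f_def phase_def rho_def w_fun_def
    by (intro continuous_intros) (use rho_pos w_fun_nonpos in \<open>auto simp: rho_def w_fun_def\<close>, metis less_irrefl)
  \<comment> \<open>The square root in the derivative of arccos: sinh^2 t - (cosh t - y)^2 = 2y (cosh t - cosh u) for y = exp u.\<close>
  have one_X: "sinh t * sqrt (1 - (X \<phi>)\<^sup>2) = exp (u \<phi> / 2) * (t * \<bar>cos \<phi>\<bar>) * sqrt (2 * K \<phi>)" for \<phi>
  proof -
    define y where "y = exp (u \<phi>)"
    have y: "0 < y" "exp (- u \<phi>) = 1 / y" by (simp_all add: y_def exp_minus field_simps)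
    have "(sinh t)\<^sup>2 * (1 - (X \<phi>)\<^sup>2) = (sinh t)\<^sup>2 - (cosh t - y)\<^sup>2"
      using sh by (simp add: X_def y_def power_divide field_simps)
    also have "\<dots> = 2 * y * cosh t - y\<^sup>2 - 1"
      by (simp add: sinh_square_eq power2_diff)
    also have "\<dots> = y * (2 * (cosh t - cosh (u \<phi>)))"
      using y(1) unfolding cosh_field_def y(2) by (simp add: y_def[symmetric] field_simps power2_eq_square)
    also have "\<dots> = y * (t * \<bar>cos \<phi>\<bar>)\<^sup>2 * (2 * K \<phi>)"
      by (simp add: vK[symmetric] v_def power_mult_distrib)
    finally have "sqrt ((sinh t)\<^sup>2 * (1 - (X \<phi>)\<^sup>2)) = sqrt (y * (t * \<bar>cos \<phi>\<bar>)\<^sup>2 * (2 * K \<phi>))" by simp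
    moreover have "sqrt y = exp (u \<phi> / 2)"
      unfolding y_def by (rule real_sqrt_unique) (simp_all flip: exp_of_nat_mult)
    ultimately show ?thesis using sh t by (simp add: real_sqrt_mult)
  qed
  have dg: "(g has_real_derivative g' \<phi>) (at \<phi> within S)" if \<phi>: "\<phi> \<in> {-pi/2..pi/2} - {-pi/2, pi/2}" for \<phi> S
  proof -
    have c: "0 < cos \<phi>" using \<phi> by (intro cos_gt_zero_pi) auto
    have "0 < sinh t * sqrt (1 - (X \<phi>)\<^sup>2)"
      unfolding one_X using c t K[of \<phi>] by simp
    then have "0 < sqrt (1 - (X \<phi>)\<^sup>2)" using sh by (simp add: zero_less_mult_iff)
    then have "(X \<phi>)\<^sup>2 < 1" by simp
    then have X1: "-1 < X \<phi>" "X \<phi> < 1" by (auto simp: abs_square_less_1 abs_less_iff)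
    have "(X has_real_derivative - (exp (u \<phi>) * (t * cos \<phi>)) / sinh t) (at \<phi> within S)"
      unfolding X_def[abs_def] u_def[abs_def]
      by (rule derivative_eq_intros refl)+ (use sh in \<open>simp_all add: field_simps\<close>)
    from DERIV_chain2[OF DERIV_arccos[OF X1] this]
    have "(g has_real_derivative inverse (- sqrt (1 - (X \<phi>)\<^sup>2)) * (- (exp (u \<phi>) * (t * cos \<phi>)) / sinh t)) (at \<phi> within S)"
      by (simp add: g_def[abs_def])
    moreover have "inverse (- sqrt (1 - (X \<phi>)\<^sup>2)) * (- (exp (u \<phi>) * (t * cos \<phi>)) / sinh t)
        = exp (u \<phi>) * (t * cos \<phi>) / (sinh t * sqrt (1 - (X \<phi>)\<^sup>2))"
      by (simp add: field_simps)
    moreover have "\<dots> = g' \<phi>"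
    proof -
      have "exp (u \<phi>) = exp (u \<phi> / 2) * exp (u \<phi> / 2)" by (simp add: mult_exp_exp)
      then show ?thesis unfolding one_X g'_def using c t by simp
    qed
    ultimately show ?thesis by simp
  qed
  have sub: "((\<lambda>\<phi>. g' \<phi> *\<^sub>R f (g \<phi>)) has_integral integral {0..pi} f) {-pi/2..pi/2}"
  proof -
    have "((\<lambda>\<phi>. g' \<phi> *\<^sub>R f (g \<phi>)) has_integral integral {g (-pi/2)..g (pi/2)} f) {-pi/2..pi/2}"
    proof (rule has_integral_substitution_strong[where s = "{-pi/2, pi/2}" and c = 0 and d = pi])
      show "g (-pi/2) \<le> g (pi/2)" unfolding g_ends by simp
      show "g ` {-pi/2..pi/2} \<subseteq> {0..pi}"
        unfolding g_def using arccos_lbound[OF X_ge X_le] arccos_ubound[OF X_ge X_le] by auto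
    qed (rule contf contg dg | assumption | simp)+
    then show ?thesis unfolding g_ends .
  qed
  \<comment> \<open>Modulus, angle and Jacobian combine to the amplitude, since sqrt (sinh t / (2t)) is the first factor of
    the profile.\<close>
  have fg: "g' \<phi> *\<^sub>R f (g \<phi>) = of_real (sqrt (t / sinh t) * p \<phi>) * cis (- (l * u \<phi>))" for \<phi>
  proof -
    have re: "Re (w_fun t (g \<phi>)) / sqrt (rho t (g \<phi>)) = cos_angle (t\<^sup>2) (v \<phi>)"
    proof -
      have "sqrt (rho t (g \<phi>)) = exp (u \<phi> / 2)"
        unfolding rho_g by (rule real_sqrt_unique) (simp_all flip: exp_of_nat_mult)
      moreover have "Re (w_fun t (g \<phi>)) = exp (u \<phi> / 2) * (cosh (u \<phi> / 2) / cosh (t/2))"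
      proof -
        have st: "sinh t = 2 * sinh (t/2) * cosh (t/2)" using sinh_double[of "t/2"] by simp
        have ct: "cosh t = 2 * (cosh (t/2))\<^sup>2 - 1" using cosh_double_cosh[of "t/2"] by simp
        have nz: "sinh (t/2) \<noteq> 0" using t by simp
        have "Re (w_fun t (g \<phi>)) = cosh (t/2) - (cosh t - exp (u \<phi>)) / (2 * cosh (t/2))"
          using nz ch by (simp add: Re_w_fun cosg X_def st)
        also have "\<dots> = (1 + exp (u \<phi>)) / (2 * cosh (t/2))"
          using ch unfolding ct by (simp add: field_simps power2_eq_square)
        also have "1 + exp (u \<phi>) = exp (u \<phi> / 2) * (2 * cosh (u \<phi> / 2))"
        proof -
          have "exp (u \<phi> / 2) * exp (u \<phi> / 2) = exp (u \<phi>)" "exp (u \<phi> / 2) * exp (- (u \<phi> / 2)) = 1"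
            by (simp_all add: mult_exp_exp)
          then show ?thesis by (simp add: cosh_field_def distrib_left)
        qed
        finally show ?thesis by simp
      qed
      moreover have "cos_angle (t\<^sup>2) (v \<phi>) = cosh (u \<phi> / 2) / cosh (t/2)"
        using cosqrt_neg_square[of "u \<phi> / 2"] cosqrt_neg_square[of "t / 2"]
        by (simp add: cos_angle_def uv power_divide)
      ultimately show ?thesis by simp
    qed
    have c: "cos (2 * n * phase t (g \<phi>)) = cosqrt 0 (4 * n\<^sup>2 * (arccos (cos_angle (t\<^sup>2) (v \<phi>)))\<^sup>2)"
      unfolding cos_phase re using cosqrt_square[of "2 * n * arccos (cos_angle (t\<^sup>2) (v \<phi>))"]
      by (simp add: power_mult_distrib)
    have K0: "0 < K \<phi>" using K[of \<phi>] by linarith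
    have "sinh t = 2 * t * (- cosqrt 1 (- t\<^sup>2))" using sinh_eq_cosqrt[of t] by simp
    then have "- cosqrt 1 (- t\<^sup>2) = sinh t / (2 * t)" using t by (simp add: field_simps)
    then have pp: "p \<phi> = sqrt (sinh t / (2 * t)) * (1 / sqrt (K \<phi>)) * cos (2 * n * phase t (g \<phi>))"
      unfolding p_def profile_def c using K0 by (simp add: K_def powr_minus_divide powr_half_sqrt)
    have "sqrt (t / sinh t) * sqrt (sinh t / (2 * t)) = sqrt (1 / 2)"
      using sh t by (simp flip: real_sqrt_mult)
    then have sp: "sqrt (t / sinh t) * p \<phi> = 1 / sqrt (2 * K \<phi>) * cos (2 * n * phase t (g \<phi>))"
      unfolding pp mult.assoc[symmetric] by (simp add: real_sqrt_divide real_sqrt_mult)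
    have "exp (- s * of_real (u \<phi>)) = of_real (exp (- u \<phi> / 2)) * cis (- (l * u \<phi>))"
    proof -
      have "- s * of_real (u \<phi>) = of_real (- u \<phi> / 2) + \<i> * of_real (- (l * u \<phi>))"
        by (simp add: s_def complex_eq_iff)
      then show ?thesis by (simp only: exp_add cis_conv_exp exp_of_real)
    qed
    then have "g' \<phi> *\<^sub>R f (g \<phi>) = of_real (g' \<phi> * exp (- u \<phi> / 2) * cos (2 * n * phase t (g \<phi>))) * cis (- (l * u \<phi>))"
      by (simp add: f_def rho_g scaleR_conv_of_real)
    also have "g' \<phi> * exp (- u \<phi> / 2) = 1 / sqrt (2 * K \<phi>)"
      by (simp add: g'_def mult_exp_exp)
    finally show ?thesis unfolding sp .
  qed
  define I where "I = integral {0..pi} f"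
  have 1: "((\<lambda>\<phi>. of_real (sqrt (t / sinh t) * p \<phi>) * cis (- (l * u \<phi>))) has_integral I) {-pi/2..pi/2}"
    using sub unfolding fg I_def .
  have "((\<lambda>\<phi>. of_real (sqrt (t / sinh t) * p (- \<phi>)) * cis (- (l * u (- \<phi>)))) has_integral I) {-pi/2..pi/2}"
    using has_integral_reflect_real[of "\<lambda>\<phi>. of_real (sqrt (t / sinh t) * p \<phi>) * cis (- (l * u \<phi>))" I "pi/2" "-pi/2"] 1
    by simp
  then have 2: "((\<lambda>\<phi>. of_real (sqrt (t / sinh t) * p \<phi>) * cis (l * u \<phi>)) has_integral I) {-pi/2..pi/2}"
    by (simp add: p_def u_def v_def)
  have "of_real (sqrt (t / sinh t) * p \<phi>) * cis (- (l * u \<phi>)) + of_real (sqrt (t / sinh t) * p \<phi>) * cis (l * u \<phi>)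
     = complex_of_real (2 * sqrt (t / sinh t) * (cos (l * u \<phi>) * p \<phi>))" for \<phi>
    by (simp add: complex_eq_iff)
  with has_integral_add[OF 1 2]
  have 3: "((\<lambda>\<phi>. complex_of_real (2 * sqrt (t / sinh t) * (cos (l * u \<phi>) * p \<phi>))) has_integral I + I) {-pi/2..pi/2}"
    by (simp only:)
  have "((\<lambda>\<phi>. 2 * sqrt (t / sinh t) * (cos (l * u \<phi>) * p \<phi>)) has_integral Re (I + I)) {-pi/2..pi/2}"
    using has_integral_linear[OF 3 bounded_linear_Re] by (simp add: o_def)
  from integral_unique[OF this]
  have Re: "2 * Re I = 2 * sqrt (t / sinh t) * integral {-pi/2..pi/2} (\<lambda>\<phi>. cos (l * u \<phi>) * p \<phi>)"
    by simp
  have "((\<lambda>\<phi>. 0) has_integral Im (I + I)) {-pi/2..pi/2}"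
    using has_integral_linear[OF 3 bounded_linear_Im] by (simp add: o_def)
  from has_integral_unique[OF this has_integral_0] have "Im I = 0" by simp
  then have "I = of_real (sqrt (t / sinh t) * integral {-pi/2..pi/2} (\<lambda>\<phi>. cos (l * u \<phi>) * p \<phi>))"
    using Re by (simp add: complex_eq_iff)
  then show ?thesis
    unfolding zeta_sph_a_mat[OF n] using I_def
    by (simp add: s_def[symmetric] f_def[abs_def] u_def p_def v_def)
qed

section \<open>The expansion\<close>

lemma set_integrable_le_inverse_square:
  fixes g :: "real \<Rightarrow> real"
  assumes cont: "continuous_on {1..} g" and g: "\<And>l. l \<ge> 1 \<Longrightarrow> 0 \<le> g l \<and> g l \<le> K / l\<^sup>2"
  shows "set_integrable lborel {1..} g \<and> (LBINT l:{1..}. g l) \<le> K"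
proof -
  have "((\<lambda>x::real. - (1 / x)) \<longlongrightarrow> 0) at_top"
    using tendsto_minus[OF tendsto_inverse_0_at_top[OF filterlim_ident]] by (simp add: inverse_eq_divide)
  then have ftc: "(\<integral>\<^sup>+x. ennreal (1 / x\<^sup>2) * indicator {1..} x \<partial>lborel) = ennreal (0 - (- (1 / 1)))"
    by (intro nn_integral_FTC_atLeast)
      (auto intro!: derivative_eq_intros simp: power2_eq_square)
  have nn: "(\<integral>\<^sup>+x. ennreal (indicator {1..} x * (1 / x\<^sup>2)) \<partial>lborel) = ennreal 1"
  proof -
    have "ennreal (indicator {1..} x * (1 / x\<^sup>2)) = ennreal (1 / x\<^sup>2) * indicator {1..} x" for x :: real
      by (simp split: split_indicator)
    with ftc show ?thesis by simp
  qed
  have hb: "has_bochner_integral lborel (\<lambda>x::real. indicator {1..} x * (1 / x\<^sup>2)) 1"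
    by (rule has_bochner_integral_nn_integral[OF _ _ _ nn]) auto
  have "has_bochner_integral lborel (\<lambda>x::real. K * (indicator {1..} x * (1 / x\<^sup>2))) (K * 1)"
    by (rule has_bochner_integral_mult_right) (rule hb)
  then have K: "set_integrable lborel {1..} (\<lambda>x. K / x\<^sup>2)" "(LBINT x:{1..}. K / x\<^sup>2) = K"
    by (simp_all add: set_integrable_def set_lebesgue_integral_def has_bochner_integral_iff mult_ac)
  have "set_integrable lborel {1..} g"
  proof (rule set_integrable_bound[OF K(1)])
    show "set_borel_measurable lborel {1..} g"
      using borel_measurable_continuous_on_indicator[OF _ cont]
      by (simp add: set_borel_measurable_def)
    have "0 \<le> K" using g[of 1] by simp
    then show "AE x in lborel. x \<in> {1..} \<longrightarrow> norm (g x) \<le> norm (K / x\<^sup>2)"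
      using g by (intro AE_I2) simp
  qed
  moreover from this have "(LBINT l:{1..}. g l) \<le> K"
    using set_integral_mono[OF _ K(1), of g] g K(2) by simp
  ultimately show ?thesis by simp
qed

text \<open>
  The three subtracted terms are the contributions of the second order Taylor polynomial of the profile at 0,
  and D is the integral with the Taylor remainder H as amplitude. Continuity in l is recorded for the
  measurability of the error.
\<close>

lemma profile_integral_expansion:
  assumes t: "0 < t" "t \<le> 1" and smooth: "smooth3 {0..t\<^sup>2} M N (profile n (t\<^sup>2))"
    and MN: "0 \<le> M" "0 \<le> N"
  defines "D \<equiv> (\<lambda>c1 c2 l. integral {-pi/2..pi/2} (\<lambda>\<phi>. cos (l * (t * sin \<phi>)) * profile n (t\<^sup>2) ((t * cos \<phi>)\<^sup>2))
      - (integral {-pi/2..pi/2} (\<lambda>\<phi>. cos (l * t * sin \<phi>) * cos \<phi> ^ (2 * 0))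
        + c1 * t ^ 2 * integral {-pi/2..pi/2} (\<lambda>\<phi>. cos (l * t * sin \<phi>) * cos \<phi> ^ (2 * 1))
        + c2 * t ^ 4 * integral {-pi/2..pi/2} (\<lambda>\<phi>. cos (l * t * sin \<phi>) * cos \<phi> ^ (2 * 2))))"
  shows "\<exists>c1 c2. \<bar>c1\<bar> \<le> M * N \<and> \<bar>c2\<bar> \<le> M * N ^ 2 \<and> continuous_on UNIV (D c1 c2) \<and>
      (\<forall>l>0. \<bar>D c1 c2 l\<bar> \<le> 90 * pi * (M * N ^ 3) / l ^ 3)"
proof -
  obtain f1 f2 f3 where f:
    "\<And>x. x \<in> {0..t\<^sup>2} \<Longrightarrow> (profile n (t\<^sup>2) has_real_derivative f1 x) (at x within {0..t\<^sup>2})"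
    "\<And>x. x \<in> {0..t\<^sup>2} \<Longrightarrow> (f1 has_real_derivative f2 x) (at x within {0..t\<^sup>2})"
    "\<And>x. x \<in> {0..t\<^sup>2} \<Longrightarrow> (f2 has_real_derivative f3 x) (at x within {0..t\<^sup>2})"
    and fb: "\<And>x. x \<in> {0..t\<^sup>2} \<Longrightarrow> \<bar>profile n (t\<^sup>2) x\<bar> \<le> M" "\<And>x. x \<in> {0..t\<^sup>2} \<Longrightarrow> \<bar>f1 x\<bar> \<le> M * N"
    "\<And>x. x \<in> {0..t\<^sup>2} \<Longrightarrow> \<bar>f2 x\<bar> \<le> M * N ^ 2" "\<And>x. x \<in> {0..t\<^sup>2} \<Longrightarrow> \<bar>f3 x\<bar> \<le> M * N ^ 3"
    by (rule smooth3E[OF smooth]) (rule that; assumption)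
  define c1 where "c1 = f1 0"
  define c2 where "c2 = f2 0 / 2"
  define H where "H v = profile n (t\<^sup>2) v - (1 + c1 * v + c2 * v\<^sup>2)" for v
  define H1 where "H1 v = f1 v - (c1 + 2 * c2 * v)" for v
  define H2 where "H2 v = f2 v - 2 * c2" for v
  define B where "B = M * N ^ 3"
  have B: "0 \<le> B" using MN by (simp add: B_def)
  have a: "0 < t\<^sup>2" "t\<^sup>2 \<le> 1" using t by (simp_all add: power_le_one)
  have d1: "(H has_real_derivative H1 v) (at v within {0..t\<^sup>2})" if "v \<in> {0..t\<^sup>2}" for v
    unfolding H_def[abs_def] by (rule derivative_eq_intros refl f that)+ (simp add: H1_def)
  have d2: "(H1 has_real_derivative H2 v) (at v within {0..t\<^sup>2})" if "v \<in> {0..t\<^sup>2}" for v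
    unfolding H1_def[abs_def] by (rule derivative_eq_intros refl f that)+ (simp add: H2_def)
  have d3: "(H2 has_real_derivative f3 v) (at v within {0..t\<^sup>2})" if "v \<in> {0..t\<^sup>2}" for v
    unfolding H2_def[abs_def] by (rule derivative_eq_intros refl f that)+ simp
  note d = d1 d2 d3
  have z: "H 0 = 0" "H1 0 = 0" "H2 0 = 0"
    using profile_0[OF a] by (simp_all add: H_def H1_def H2_def c1_def c2_def)
  have b3: "\<bar>f3 v\<bar> \<le> B * v ^ 0" if "v \<in> {0..t\<^sup>2}" for v
    using fb(4)[OF that] by (simp add: B_def)
  have b2: "\<bar>H2 v\<bar> \<le> B * v ^ Suc 0" if "v \<in> {0..t\<^sup>2}" for v
    by (rule abs_le_mult_power_Suc[OF d(3) b3 z(3) B that])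
  have b1: "\<bar>H1 v\<bar> \<le> B * v ^ Suc (Suc 0)" if "v \<in> {0..t\<^sup>2}" for v
    by (rule abs_le_mult_power_Suc[OF d(2) b2 z(2) B that])
  have b0: "\<bar>H v\<bar> \<le> B * v ^ Suc (Suc (Suc 0))" if "v \<in> {0..t\<^sup>2}" for v
    by (rule abs_le_mult_power_Suc[OF d(1) b1 z(1) B that])
  have v: "(t * cos \<phi>)\<^sup>2 \<in> {0..t\<^sup>2}" for \<phi>
    using abs_square_le_1[of "cos \<phi>"] by (simp add: power_mult_distrib mult_left_le)
  have cH: "continuous_on S (\<lambda>x. H ((t * cos (h x))\<^sup>2))" if "continuous_on S h" for S :: "'b::t2_space set" and h
    by (rule continuous_on_compose2[OF DERIV_continuous_on[OF d(1)]])
      (use v that in \<open>auto intro!: continuous_intros\<close>)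
  have DH: "D c1 c2 l = integral {-pi/2..pi/2} (\<lambda>\<phi>. cos (l * (t * sin \<phi>)) * H ((t * cos \<phi>)\<^sup>2))" for l
  proof -
    define A where "A j = integral {-pi/2..pi/2} (\<lambda>\<phi>. cos (l * t * sin \<phi>) * cos \<phi> ^ (2 * j))" for j
    have A: "((\<lambda>\<phi>. cos (l * t * sin \<phi>) * cos \<phi> ^ (2 * j)) has_integral A j) {-pi/2..pi/2}" for j
      unfolding A_def by (intro integrable_integral integrable_continuous_real continuous_intros)
    have "((\<lambda>\<phi>. cos (l * (t * sin \<phi>)) * H ((t * cos \<phi>)\<^sup>2)) has_integral
        integral {-pi/2..pi/2} (\<lambda>\<phi>. cos (l * (t * sin \<phi>)) * H ((t * cos \<phi>)\<^sup>2))) {-pi/2..pi/2}"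
      by (intro integrable_integral integrable_continuous_real continuous_intros cH)
    from has_integral_add[OF this has_integral_add[OF has_integral_add[OF A[of 0]
          has_integral_mult_right[OF A[of 1], of "c1 * t\<^sup>2"]] has_integral_mult_right[OF A[of 2], of "c2 * t ^ 4"]]]
    have "((\<lambda>\<phi>. cos (l * (t * sin \<phi>)) * H ((t * cos \<phi>)\<^sup>2) + (cos (l * t * sin \<phi>) * cos \<phi> ^ (2 * 0)
          + c1 * t\<^sup>2 * (cos (l * t * sin \<phi>) * cos \<phi> ^ (2 * 1)) + c2 * t ^ 4 * (cos (l * t * sin \<phi>) * cos \<phi> ^ (2 * 2))))
       has_integral integral {-pi/2..pi/2} (\<lambda>\<phi>. cos (l * (t * sin \<phi>)) * H ((t * cos \<phi>)\<^sup>2))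
         + (A 0 + c1 * t\<^sup>2 * A 1 + c2 * t ^ 4 * A 2)) {-pi/2..pi/2}" .
    moreover have "cos (l * (t * sin \<phi>)) * H ((t * cos \<phi>)\<^sup>2) + (cos (l * t * sin \<phi>) * cos \<phi> ^ (2 * 0)
          + c1 * t\<^sup>2 * (cos (l * t * sin \<phi>) * cos \<phi> ^ (2 * 1)) + c2 * t ^ 4 * (cos (l * t * sin \<phi>) * cos \<phi> ^ (2 * 2)))
       = cos (l * (t * sin \<phi>)) * profile n (t\<^sup>2) ((t * cos \<phi>)\<^sup>2)" for \<phi>
      unfolding H_def by (simp add: power_mult_distrib mult.assoc flip: power_mult) (simp add: algebra_simps)
    ultimately show ?thesis
      unfolding D_def A_def by (simp add: integral_unique)
  qed
  have "continuous_on UNIV (\<lambda>l. integral (cbox (-pi/2) (pi/2)) (\<lambda>\<phi>. cos (l * (t * sin \<phi>)) * H ((t * cos \<phi>)\<^sup>2)))"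
    by (rule integral_continuous_on_param) (auto simp: split_def intro!: continuous_intros cH)
  then have "continuous_on UNIV (D c1 c2)" by (simp add: DH[abs_def])
  moreover have "\<bar>D c1 c2 l\<bar> \<le> 90 * pi * (M * N ^ 3) / l ^ 3" if "l > 0" for l
    unfolding DH B_def[symmetric]
    by (rule oscillatory_integral_bound[OF t that d])
      (use b0 b1 b2 b3 B in \<open>auto simp: numeral_2_eq_2 numeral_3_eq_3\<close>)
  moreover have "\<bar>c1\<bar> \<le> M * N" "\<bar>c2\<bar> \<le> M * N ^ 2"
    using fb(2,3)[of 0] a by (auto simp: c1_def c2_def)
  ultimately show ?thesis by blast
qed

lemma zeta_sph_one:
  assumes "2 * n \<in> \<int>"
  shows "zeta_sph n s (a_mat 0) = 1"
proof -
  have "rho 0 \<theta> = 1" "phase 0 \<theta> = 0" for \<theta>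
    by (simp_all add: rho_def phase_def w_fun_def)
  then show ?thesis by (simp add: zeta_sph_a_mat[OF assms] scaleR_conv_of_real)
qed

theorem lemma4p4:
  shows "\<exists>(C::real) (b0::complex). \<forall>n::real. 2 * n \<in> \<int> \<longrightarrow>
    (\<exists>(b :: nat \<Rightarrow> real \<Rightarrow> complex) (E :: real \<Rightarrow> real \<Rightarrow> complex).
      (\<forall>t\<in>{0..1}. \<forall>l\<ge>0.
         zeta_sph n (1/2 + \<i> * of_real l) (a_mat t) =
           of_real (sqrt_t_over_sinh t) *
             (\<Sum>j\<le>2. of_real (t ^ (2 * j)) * b j t * of_real (cal_J (real j) (l * t)))
           + E l t) \<and>
      (\<forall>t\<in>{0..1}. b 0 t = b0) \<and>
      (\<forall>j\<in>{1, 2}. \<forall>t\<in>{0..1}. norm (b j t) \<le> C * (1 + \<bar>n\<bar>) ^ 4) \<and>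
      (\<forall>t\<in>{0..1}.
         set_integrable lborel {1..} (\<lambda>l. norm (E l t) * l) \<and>
         (LBINT l:{1..}. norm (E l t) * l) \<le> C * (1 + \<bar>n\<bar>) ^ 6))"
proof -
  obtain M where M: "M \<ge> 1" and smooth:
    "\<And>n a. 0 < a \<Longrightarrow> a \<le> 1 \<Longrightarrow> smooth3 {0..a} M (4 * (1 + \<bar>n\<bar>)\<^sup>2) (profile n a)"
    by (rule smooth3_profile) (rule that; assumption)
  \<comment> \<open>The error bound is 90 M N^3 with N = 4 (1+|n|)^2, and 90 * 4^3 < 6000.\<close>
  define C where "C = 6000 * M"
  define b0 where "b0 = complex_of_real (2 / sqrt pi)"
  have spi: "1 \<le> sqrt pi" using pi_ge_two by simp
  show ?thesis
  proof (rule exI[of _ C], rule exI[of _ b0], intro allI impI)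
    fix n :: real assume n: "2 * n \<in> \<int>"
    define N where "N = 4 * (1 + \<bar>n\<bar>)\<^sup>2"
    have N: "0 \<le> N" by (simp add: N_def)
    define D where "D t c1 c2 l = integral {-pi/2..pi/2} (\<lambda>\<phi>. cos (l * (t * sin \<phi>)) * profile n (t\<^sup>2) ((t * cos \<phi>)\<^sup>2))
      - (integral {-pi/2..pi/2} (\<lambda>\<phi>. cos (l * t * sin \<phi>) * cos \<phi> ^ (2 * 0))
        + c1 * t ^ 2 * integral {-pi/2..pi/2} (\<lambda>\<phi>. cos (l * t * sin \<phi>) * cos \<phi> ^ (2 * 1))
        + c2 * t ^ 4 * integral {-pi/2..pi/2} (\<lambda>\<phi>. cos (l * t * sin \<phi>) * cos \<phi> ^ (2 * 2)))" for t c1 c2 l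
    have "\<exists>c1 c2. \<bar>c1\<bar> \<le> M * N \<and> \<bar>c2\<bar> \<le> M * N ^ 2 \<and> continuous_on UNIV (D t c1 c2) \<and>
        (\<forall>l>0. \<bar>D t c1 c2 l\<bar> \<le> 90 * pi * (M * N ^ 3) / l ^ 3)" if "t \<in> {0<..1}" for t
    proof -
      have t: "0 < t" "t \<le> 1" using that by auto
      have "smooth3 {0..t\<^sup>2} M N (profile n (t\<^sup>2))"
        unfolding N_def by (rule smooth) (use t in \<open>simp_all add: power_le_one\<close>)
      from profile_integral_expansion[OF t this] M N show ?thesis
        unfolding D_def[abs_def] by simp
    qed
    then obtain c1 c2 where c: "\<And>t. t \<in> {0<..1} \<Longrightarrow> \<bar>c1 t\<bar> \<le> M * N"
      "\<And>t. t \<in> {0<..1} \<Longrightarrow> \<bar>c2 t\<bar> \<le> M * N ^ 2"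
      "\<And>t. t \<in> {0<..1} \<Longrightarrow> continuous_on UNIV (D t (c1 t) (c2 t))"
      "\<And>t l. t \<in> {0<..1} \<Longrightarrow> 0 < l \<Longrightarrow> \<bar>D t (c1 t) (c2 t) l\<bar> \<le> 90 * pi * (M * N ^ 3) / l ^ 3"
      by metis
    \<comment> \<open>At t = 0 the terms with j > 0 carry the factor t^(2j) = 0, so any bounded values of b 1 and b 2 serve.\<close>
    define \<beta> where "\<beta> j t = (if j = 0 then 1 else if t = 0 then 0 else if j = 1 then c1 t else c2 t)"
      for j :: nat and t
    define b where "b j t = complex_of_real (2 / sqrt pi * \<beta> j t)" for j t
    define E where "E l t = zeta_sph n (1/2 + \<i> * of_real l) (a_mat t) - of_real (sqrt_t_over_sinh t) *
             (\<Sum>j\<le>2. of_real (t ^ (2 * j)) * b j t * of_real (cal_J (real j) (l * t)))" for l t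
    have E0: "E l 0 = 0" for l
      by (simp add: E_def zeta_sph_one[OF n] sqrt_t_over_sinh_def numeral_2_eq_2 b_def \<beta>_def cal_J_0_0)
    have ED: "E l t = of_real (sqrt (t / sinh t) / pi * D t (c1 t) (c2 t) l)"
      if t: "t \<in> {0<..1}" and l: "0 < l" for l t
    proof -
      define A where "A j = integral {-pi/2..pi/2} (\<lambda>\<phi>. cos (l * t * sin \<phi>) * cos \<phi> ^ (2 * j))" for j
      have lt: "0 < l * t" using t l by simp
      then have J: "cal_J (real j) (l * t) = A j / (2 * sqrt pi)" for j
        using poisson_integral[OF lt, of j] t l by (simp add: cal_J_def A_def)
      have pp: "2 / sqrt pi * x * (y / (2 * sqrt pi)) = x * y / pi" for x y
        by simp
      have "(\<Sum>j\<le>2. of_real (t ^ (2 * j)) * b j t * of_real (cal_J (real j) (l * t)))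
        = complex_of_real (\<Sum>j\<le>2. t ^ (2 * j) * (2 / sqrt pi * \<beta> j t * (A j / (2 * sqrt pi))))"
        unfolding b_def J of_real_sum of_real_mult by (simp only: mult.assoc)
      also have "(\<Sum>j\<le>2. t ^ (2 * j) * (2 / sqrt pi * \<beta> j t * (A j / (2 * sqrt pi))))
        = (A 0 + c1 t * t ^ 2 * A 1 + c2 t * t ^ 4 * A 2) / pi"
        unfolding pp using t by (simp add: numeral_2_eq_2 \<beta>_def field_simps eval_nat_numeral)
      finally have sum_eq: "(\<Sum>j\<le>2. of_real (t ^ (2 * j)) * b j t * of_real (cal_J (real j) (l * t)))
        = complex_of_real ((A 0 + c1 t * t ^ 2 * A 1 + c2 t * t ^ 4 * A 2) / pi)" .
      have "0 < t" "t \<le> 1" using t by auto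
      note z = zeta_sph_eq_profile_integral[OF n this, of l]
      have "sqrt_t_over_sinh t = sqrt (t / sinh t)" using t by (simp add: sqrt_t_over_sinh_def)
      then show ?thesis
        unfolding E_def z sum_eq D_def A_def[symmetric] of_real_mult[symmetric] of_real_diff[symmetric]
        by (simp add: right_diff_distrib diff_divide_distrib)
    qed
    have E_int: "set_integrable lborel {1..} (\<lambda>l. norm (E l t) * l) \<and>
        (LBINT l:{1..}. norm (E l t) * l) \<le> C * (1 + \<bar>n\<bar>) ^ 6" if "t \<in> {0..1}" for t
    proof (cases "t = 0")
      case True
      then show ?thesis using M by (simp add: E0 C_def set_integrable_def)
    next
      case False
      then have t: "t \<in> {0<..1}" using that by auto
      define g where "g l = \<bar>sqrt (t / sinh t) / pi * D t (c1 t) (c2 t) l\<bar> * l" for l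
      have g: "norm (E l t) * l = g l" if "l \<in> {1..}" for l
      proof -
        have "0 < l" using that by simp
        from ED[OF t this] show ?thesis by (simp only: g_def norm_of_real)
      qed
      have "t\<^sup>2 \<le> 1" using t by (simp add: power_le_one)
      then have "1/2 \<le> - cosqrt 1 (- t\<^sup>2)" by (intro cosqrt_1_neg_ge) auto
      then have "t * 1 \<le> t * (- 2 * cosqrt 1 (- t\<^sup>2))" using t by (intro mult_left_mono) auto
      then have "t \<le> sinh t" using sinh_eq_cosqrt[of t] by simp
      then have S: "\<bar>sqrt (t / sinh t)\<bar> \<le> 1" using t by (simp add: divide_le_eq)
      have "continuous_on {1..} g"
        unfolding g_def
        by (intro continuous_intros continuous_on_subset[OF c(3)[OF t]]) auto
      moreover have "0 \<le> g l \<and> g l \<le> (90 * (M * N ^ 3)) / l\<^sup>2" if l: "l \<ge> 1" for l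
      proof -
        have "\<bar>sqrt (t / sinh t) / pi * D t (c1 t) (c2 t) l\<bar> = \<bar>sqrt (t / sinh t)\<bar> * \<bar>D t (c1 t) (c2 t) l\<bar> / pi"
          by (simp add: abs_mult)
        also have "\<dots> \<le> 1 * (90 * pi * (M * N ^ 3) / l ^ 3) / pi"
          using S c(4)[OF t, of l] l by (intro divide_right_mono mult_mono) auto
        finally have "\<bar>sqrt (t / sinh t) / pi * D t (c1 t) (c2 t) l\<bar> * l \<le> 90 * (M * N ^ 3) / l ^ 3 * l"
          using l by (intro mult_right_mono) auto
        also have "\<dots> = 90 * (M * N ^ 3) / l\<^sup>2"
          using l by (simp add: power3_eq_cube power2_eq_square)
        finally show ?thesis using l by (simp add: g_def)
      qed
      ultimately have "set_integrable lborel {1..} g \<and> (LBINT l:{1..}. g l) \<le> 90 * (M * N ^ 3)"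
        by (rule set_integrable_le_inverse_square)
      moreover have "90 * (M * N ^ 3) \<le> C * (1 + \<bar>n\<bar>) ^ 6"
        using M by (simp add: N_def C_def power_mult_distrib flip: power_mult)
      moreover have "set_integrable lborel {1..} (\<lambda>l. norm (E l t) * l) \<longleftrightarrow> set_integrable lborel {1..} g"
        by (rule set_integrable_cong) (use g in auto)
      moreover have "(LBINT l:{1..}. norm (E l t) * l) = (LBINT l:{1..}. g l)"
        by (rule set_lebesgue_integral_cong) (use g in auto)
      ultimately show ?thesis by auto
    qed
    have b_bound: "norm (b j t) \<le> C * (1 + \<bar>n\<bar>) ^ 4" if j: "j \<in> {1, 2}" and t: "t \<in> {0..1}" for j t
    proof -
      define q where "q = (1 + \<bar>n\<bar>)\<^sup>2"
      have q: "1 \<le> q" unfolding q_def by (rule one_le_power) simp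
      then have q2: "q \<le> q\<^sup>2" by (simp add: power2_eq_square)
      have "M * q \<le> M * q\<^sup>2" "0 \<le> M * q\<^sup>2" using q2 M by (auto intro: mult_left_mono)
      then have "\<bar>\<beta> j t\<bar> \<le> 16 * (M * q\<^sup>2)"
        using j t c(1,2)[of t] by (auto simp: \<beta>_def N_def q_def[symmetric] power_mult_distrib)
      moreover have "2 / sqrt pi \<le> 2" using spi by (simp add: divide_le_eq)
      ultimately have "\<bar>2 / sqrt pi * \<beta> j t\<bar> \<le> 2 * (16 * (M * q\<^sup>2))"
        using spi by (intro abs_mult_le) auto
      also have "\<dots> \<le> C * q\<^sup>2" using M by (simp add: C_def)
      also have "q\<^sup>2 = (1 + \<bar>n\<bar>) ^ 4" by (simp add: q_def flip: power_mult)
      finally show ?thesis by (simp only: b_def norm_of_real)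
    qed
    show "\<exists>(b :: nat \<Rightarrow> real \<Rightarrow> complex) (E :: real \<Rightarrow> real \<Rightarrow> complex).
      (\<forall>t\<in>{0..1}. \<forall>l\<ge>0.
         zeta_sph n (1/2 + \<i> * of_real l) (a_mat t) =
           of_real (sqrt_t_over_sinh t) *
             (\<Sum>j\<le>2. of_real (t ^ (2 * j)) * b j t * of_real (cal_J (real j) (l * t)))
           + E l t) \<and>
      (\<forall>t\<in>{0..1}. b 0 t = b0) \<and>
      (\<forall>j\<in>{1, 2}. \<forall>t\<in>{0..1}. norm (b j t) \<le> C * (1 + \<bar>n\<bar>) ^ 4) \<and>
      (\<forall>t\<in>{0..1}.
         set_integrable lborel {1..} (\<lambda>l. norm (E l t) * l) \<and>
         (LBINT l:{1..}. norm (E l t) * l) \<le> C * (1 + \<bar>n\<bar>) ^ 6)"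
      by (intro exI[of _ b] exI[of _ E] conjI ballI b_bound E_int[THEN conjunct1] E_int[THEN conjunct2])
        (auto simp: E_def b_def b0_def \<beta>_def)
  qed
qed

end
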